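(* There exists a polynomial-time algorithm that computes from a CNF formula $\varphi$ a (two-dimensional) cellular automaton $A_\varphi$ and integers $n,m\ge 1$ such that $\varphi$ is satisfiable if and only if $A_\varphi$ is not injective on configurations inside $[n+1]\times[m+2]$.
   Context: $[k]=\{0,1,\dots,k-1\}$. A two-dimensional cellular automaton is $(2,S,N,f)$, where $S\neq\emptyset$ is a finite set of states, the neighbourhood $N=(x_1,\dots,x_v)$ is a tuple of distinct vectors of $\mathbb Z^2$, and $f:S^v\to S$ is the local function. A configuration is a map $C:\mathbb Z^2\to S$. The automaton acts on configurations by $A(C)(y)=f(C(y+x_1),\dots,C(y+x_v))$ for $y\in\mathbb Z^2$. A distinguished state $q\in S$ with $f(q,\dots,q)=q$ is called quiescent. A finite configuration (only finitely many cells in a non-quiescent state) is inside $[i]\times[j]$ if all its non-quiescent cells are located at positions in $[i]\times[j]$. "Injective on configurations inside $[i]\times[j]$" means that $A(C)=A(C')$ implies $C=C'$ for all such configurations $C,C'$. The automaton is output with its local function given by its table (one row for each element of $S^v$, with states coded by binary strings). Polynomial time is measured in the size of $\varphi$. *)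

theory Defs
  imports Complex_Main "HOL-Library.Product_Plus"
begin

section \<open>CNF formulas\<close>

datatype literal = Pos nat | Neg nat

type_synonym clause = "literal list"
type_synonym cnf = "clause list"

fun literal_true :: "(nat \<Rightarrow> bool) \<Rightarrow> literal \<Rightarrow> bool" where
  "literal_true \<alpha> (Pos x) = \<alpha> x"
| "literal_true \<alpha> (Neg x) = (\<not> \<alpha> x)"

definition satisfies :: "(nat \<Rightarrow> bool) \<Rightarrow> cnf \<Rightarrow> bool" where
  "satisfies \<alpha> \<phi> \<longleftrightarrow> (\<forall>c \<in> set \<phi>. \<exists>l \<in> set c. literal_true \<alpha> l)"

definition satisfiable :: "cnf \<Rightarrow> bool" where
  "satisfiable \<phi> \<longleftrightarrow> (\<exists>\<alpha>. satisfies \<alpha> \<phi>)"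


section \<open>Two-dimensional cellular automata\<close>

text \<open>Elements of \<open>S\<^sup>v\<close> are lists of length \<open>v\<close>. The local function is a total function on lists;
  only its values on \<open>S\<^sup>v\<close> are constrained, and only these are used.\<close>

record 's cellular_automaton =
  ca_states :: "'s set"
  ca_nbhd :: "(int \<times> int) list"
  ca_local :: "'s list \<Rightarrow> 's"

definition tuples :: "'s set \<Rightarrow> nat \<Rightarrow> 's list set" where
  "tuples S v = {xs. set xs \<subseteq> S \<and> length xs = v}"

definition wf_ca :: "'s cellular_automaton \<Rightarrow> bool" where
  "wf_ca A \<longleftrightarrow> finite (ca_states A) \<and> ca_states A \<noteq> {} \<and> distinct (ca_nbhd A) \<and>
     (\<forall>xs \<in> tuples (ca_states A) (length (ca_nbhd A)). ca_local A xs \<in> ca_states A)"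

definition quiescent :: "'s cellular_automaton \<Rightarrow> 's \<Rightarrow> bool" where
  "quiescent A q \<longleftrightarrow> q \<in> ca_states A \<and> ca_local A (replicate (length (ca_nbhd A)) q) = q"

definition configuration :: "'s cellular_automaton \<Rightarrow> (int \<times> int \<Rightarrow> 's) \<Rightarrow> bool" where
  "configuration A C \<longleftrightarrow> range C \<subseteq> ca_states A"

definition ca_apply :: "'s cellular_automaton \<Rightarrow> (int \<times> int \<Rightarrow> 's) \<Rightarrow> (int \<times> int \<Rightarrow> 's)" where
  "ca_apply A C y = ca_local A (map (\<lambda>x. C (y + x)) (ca_nbhd A))"

definition finite_configuration ::
    "'s cellular_automaton \<Rightarrow> 's \<Rightarrow> (int \<times> int \<Rightarrow> 's) \<Rightarrow> bool" where
  "finite_configuration A q C \<longleftrightarrow> configuration A C \<and> finite {y. C y \<noteq> q}"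

definition configs_inside ::
    "'s cellular_automaton \<Rightarrow> 's \<Rightarrow> nat \<Rightarrow> nat \<Rightarrow> (int \<times> int \<Rightarrow> 's) set" where
  "configs_inside A q i j =
     {C. finite_configuration A q C \<and> {y. C y \<noteq> q} \<subseteq> {0..<int i} \<times> {0..<int j}}"

definition injective_inside :: "'s cellular_automaton \<Rightarrow> 's \<Rightarrow> nat \<Rightarrow> nat \<Rightarrow> bool" where
  "injective_inside A q i j \<longleftrightarrow> inj_on (ca_apply A) (configs_inside A q i j)"


section \<open>Cellular automata given by tables\<close>

record ca_table =
  tab_states :: "bool list list"
  tab_nbhd :: "(int \<times> int) list"
  tab_rows :: "(bool list list \<times> bool list) list"
  tab_quiescent :: "bool list"

definition ca_of :: "ca_table \<Rightarrow> bool list cellular_automaton" where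
  "ca_of T = \<lparr>ca_states = set (tab_states T), ca_nbhd = tab_nbhd T,
     ca_local = (\<lambda>xs. the (map_of (tab_rows T) xs))\<rparr>"

definition wf_ca_table :: "ca_table \<Rightarrow> bool" where
  "wf_ca_table T \<longleftrightarrow> distinct (tab_states T) \<and>
     distinct (map fst (tab_rows T)) \<and>
     set (map fst (tab_rows T)) = tuples (set (tab_states T)) (length (tab_nbhd T)) \<and>
     wf_ca (ca_of T) \<and> quiescent (ca_of T) (tab_quiescent T)"


section \<open>Binary encodings\<close>

text \<open>Each list element is preceded by a 1-bit and the end of the list is marked by a 0-bit, so
  that encodings are self-delimiting and pairs can be encoded by concatenation. Numbers are in
  binary, least significant bit first, without superfluous zeros.\<close>

definition enc_list :: "('a \<Rightarrow> bool list) \<Rightarrow> 'a list \<Rightarrow> bool list" where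
  "enc_list e xs = concat (map (\<lambda>x. True # e x) xs) @ [False]"

definition enc_pair :: "('a \<Rightarrow> bool list) \<Rightarrow> ('b \<Rightarrow> bool list) \<Rightarrow> 'a \<times> 'b \<Rightarrow> bool list" where
  "enc_pair e e' p = e (fst p) @ e' (snd p)"

definition enc_bits :: "bool list \<Rightarrow> bool list" where
  "enc_bits = enc_list (\<lambda>b. [b])"

fun nat_bits :: "nat \<Rightarrow> bool list" where
  "nat_bits n = (if n = 0 then [] else odd n # nat_bits (n div 2))"

declare nat_bits.simps [simp del]

definition enc_nat :: "nat \<Rightarrow> bool list" where
  "enc_nat n = enc_bits (nat_bits n)"

definition enc_int :: "int \<Rightarrow> bool list" where
  "enc_int i = (i < 0) # enc_nat (nat \<bar>i\<bar>)"

fun enc_literal :: "literal \<Rightarrow> bool list" where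
  "enc_literal (Pos x) = True # enc_nat x"
| "enc_literal (Neg x) = False # enc_nat x"

definition enc_cnf :: "cnf \<Rightarrow> bool list" where
  "enc_cnf = enc_list (enc_list enc_literal)"

definition enc_ca_table :: "ca_table \<Rightarrow> bool list" where
  "enc_ca_table T =
     enc_list enc_bits (tab_states T) @
     enc_list (enc_pair enc_int enc_int) (tab_nbhd T) @
     enc_list (enc_pair (enc_list enc_bits) enc_bits) (tab_rows T) @
     enc_bits (tab_quiescent T)"

definition enc_output :: "ca_table \<times> nat \<times> nat \<Rightarrow> bool list" where
  "enc_output = enc_pair enc_ca_table (enc_pair enc_nat enc_nat)"

text \<open>The encodings are prefix-free, in particular injective.\<close>

definition prefix_free :: "('a \<Rightarrow> bool list) \<Rightarrow> bool" where
  "prefix_free e \<longleftrightarrow> (\<forall>x y u v. e x @ u = e y @ v \<longrightarrow> x = y \<and> u = v)"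

lemma prefix_freeD: "prefix_free e \<Longrightarrow> e x @ u = e y @ v \<Longrightarrow> x = y \<and> u = v"
  unfolding prefix_free_def by blast

lemma prefix_free_inj: "prefix_free e \<Longrightarrow> inj e"
  by (metis injI prefix_freeD)

lemma prefix_free_list: "prefix_free (enc_list e)" if e: "prefix_free e"
proof -
  have "xs = ys \<and> u = v" if "enc_list e xs @ u = enc_list e ys @ v" for xs ys u v
    using that
  proof (induction xs arbitrary: ys)
    case Nil
    then show ?case by (cases ys) (auto simp: enc_list_def)
  next
    case (Cons x xs)
    then obtain y ys' where ys: "ys = y # ys'"
      by (cases ys) (auto simp: enc_list_def)
    have "e x @ (enc_list e xs @ u) = e y @ (enc_list e ys' @ v)"
      using Cons.prems by (simp add: ys enc_list_def)
    from prefix_freeD[OF e this] Cons.IH show ?case by (simp add: ys)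
  qed
  then show ?thesis unfolding prefix_free_def by blast
qed

lemma prefix_free_pair:
  assumes "prefix_free e" "prefix_free e'"
  shows "prefix_free (enc_pair e e')"
  unfolding prefix_free_def enc_pair_def
  by (metis append_assoc assms prefix_freeD prod.collapse)

lemma prefix_free_bits: "prefix_free enc_bits"
  unfolding enc_bits_def by (rule prefix_free_list) (simp add: prefix_free_def)

lemma nat_bits_inverse: "horner_sum of_bool 2 (nat_bits n) = n"
proof (induction n rule: nat_bits.induct)
  case (1 n)
  then show ?case by (subst nat_bits.simps) (auto simp: odd_iff_mod_2_eq_one)
qed

lemma prefix_free_nat: "prefix_free enc_nat"
  unfolding prefix_free_def enc_nat_def by (metis nat_bits_inverse prefix_free_bits prefix_freeD)

lemma prefix_free_int: "prefix_free enc_int"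
  unfolding prefix_free_def
proof (intro allI impI)
  fix i j u v assume eq: "enc_int i @ u = enc_int j @ v"
  then have "(i < 0) = (j < 0)" "enc_nat (nat \<bar>i\<bar>) @ u = enc_nat (nat \<bar>j\<bar>) @ v"
    by (auto simp: enc_int_def)
  with prefix_freeD[OF prefix_free_nat this(2)] show "i = j \<and> u = v" by auto
qed

lemma prefix_free_literal: "prefix_free enc_literal"
  unfolding prefix_free_def
proof (intro allI impI)
  fix l l' u v assume "enc_literal l @ u = enc_literal l' @ v"
  then show "l = l' \<and> u = v"
    by (cases l; cases l') (auto dest: prefix_freeD[OF prefix_free_nat])
qed

lemma prefix_free_cnf: "prefix_free enc_cnf"
  unfolding enc_cnf_def by (intro prefix_free_list prefix_free_literal)

lemma prefix_free_ca_table: "prefix_free enc_ca_table"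
  unfolding prefix_free_def
proof (intro allI impI)
  fix T T' u v assume eq: "enc_ca_table T @ u = enc_ca_table T' @ v"
  have states: "prefix_free (enc_list enc_bits)"
    and nbhd: "prefix_free (enc_list (enc_pair enc_int enc_int))"
    and rows: "prefix_free (enc_list (enc_pair (enc_list enc_bits) enc_bits))"
    by (intro prefix_free_list prefix_free_pair prefix_free_bits prefix_free_int)+
  have "tab_states T = tab_states T' \<and> tab_nbhd T = tab_nbhd T' \<and> tab_rows T = tab_rows T' \<and>
      tab_quiescent T = tab_quiescent T' \<and> u = v"
    using eq unfolding enc_ca_table_def append_assoc
    by (blast dest: prefix_freeD[OF states] prefix_freeD[OF nbhd] prefix_freeD[OF rows]
        prefix_freeD[OF prefix_free_bits])
  then show "T = T' \<and> u = v" by simp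
qed

lemma prefix_free_output: "prefix_free enc_output"
  unfolding enc_output_def
  by (intro prefix_free_pair prefix_free_ca_table prefix_free_nat)


section \<open>Polynomial-time computable functions\<close>

text \<open>Deterministic multi-tape Turing machines with two-way infinite tapes. States are the numbers
  below \<open>tm_states\<close>, tape symbols the numbers below \<open>tm_symbols\<close>; the symbol \<open>0\<close> is the blank, and
  \<open>1\<close> and \<open>2\<close> represent the input and output bits 0 and 1. The input is on tape \<open>0\<close>, the output
  on tape \<open>1\<close>. A step maps the current state and the symbols under the heads to a new state and,
  for each tape, a symbol to write and a subsequent head move.\<close>

datatype move = MoveLeft | Stay | MoveRight

fun offset :: "move \<Rightarrow> int" where
  "offset MoveLeft = -1"
| "offset Stay = 0"
| "offset MoveRight = 1"

record tm =
  tm_tapes :: nat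
  tm_symbols :: nat
  tm_states :: nat
  tm_start :: nat
  tm_halt :: nat
  tm_trans :: "nat \<Rightarrow> nat list \<Rightarrow> nat \<times> (nat \<times> move) list"

definition wf_tm :: "tm \<Rightarrow> bool" where
  "wf_tm M \<longleftrightarrow> tm_tapes M \<ge> 2 \<and> tm_symbols M \<ge> 3 \<and>
     tm_start M < tm_states M \<and> tm_halt M < tm_states M \<and>
     (\<forall>q < tm_states M. \<forall>xs \<in> tuples {..<tm_symbols M} (tm_tapes M).
        fst (tm_trans M q xs) < tm_states M \<and>
        length (snd (tm_trans M q xs)) = tm_tapes M \<and>
        (\<forall>(s, d) \<in> set (snd (tm_trans M q xs)). s < tm_symbols M))"

text \<open>A tape is given by its head position and its contents.\<close>

type_synonym tape = "int \<times> (int \<Rightarrow> nat)"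

definition read_tape :: "tape \<Rightarrow> nat" where
  "read_tape t = snd t (fst t)"

definition act :: "nat \<times> move \<Rightarrow> tape \<Rightarrow> tape" where
  "act a t = (fst t + offset (snd a), (snd t)(fst t := fst a))"

type_synonym tm_config = "nat \<times> tape list"

definition tm_step :: "tm \<Rightarrow> tm_config \<Rightarrow> tm_config" where
  "tm_step M c =
     (if fst c = tm_halt M then c
      else let (q, acts) = tm_trans M (fst c) (map read_tape (snd c))
           in (q, map2 act acts (snd c)))"

definition tape_contents :: "bool list \<Rightarrow> int \<Rightarrow> nat" where
  "tape_contents w i =
     (if 0 \<le> i \<and> i < int (length w) then (if w ! nat i then 2 else 1) else 0)"

definition tm_init :: "tm \<Rightarrow> bool list \<Rightarrow> tm_config" where
  "tm_init M w =
     (tm_start M, (0, tape_contents w) # replicate (tm_tapes M - 1) (0, tape_contents []))"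

definition tm_outputs_within :: "tm \<Rightarrow> bool list \<Rightarrow> nat \<Rightarrow> bool list \<Rightarrow> bool" where
  "tm_outputs_within M w t v \<longleftrightarrow>
     (let c = (tm_step M ^^ t) (tm_init M w)
      in fst c = tm_halt M \<and> snd (snd c ! 1) = tape_contents v)"

definition poly_time_computable ::
    "('a \<Rightarrow> bool list) \<Rightarrow> ('b \<Rightarrow> bool list) \<Rightarrow> ('a \<Rightarrow> 'b) \<Rightarrow> bool" where
  "poly_time_computable enc_in enc_out f \<longleftrightarrow>
     (\<exists>M c k. wf_tm M \<and>
        (\<forall>x. tm_outputs_within M (enc_in x) (c + c * length (enc_in x) ^ k) (enc_out (f x))))"

end

theory Submission
  imports Defs
begin

text \<open>
  Let \<open>w\<close> be the encoding of \<open>\<phi>\<close>. A tableau for \<open>w\<close> is a rectangle of tiles with one column per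
  position of \<open>w\<close>. Each row parses \<open>w\<close> from left to right, guesses the truth value of every literal
  occurrence and checks that each clause contains a true literal. Row \<open>t\<close> moreover carries a copy of
  the bottom row that is shifted by \<open>t\<close> positions, and compares the two: occurrences of the same
  variable at distance \<open>t\<close> must have received the same value. So a tableau exists iff \<open>\<phi>\<close> is satisfiable.

  The states of the automaton are pairs of a position of \<open>w\<close> and a tile with three additional bits.
  The automaton changes only the bits: in a cell whose tile fits its surroundings, each bit is
  added modulo 2 to its successor on a closed walk that traverses every row of the tableau to the
  right (bit 0) and back (bit 1), climbs at the left border and finally descends there (bit 2). Two
  distinct finite configurations with the same image must differ along a complete closed walk, all
  of whose cells fit, hence contain a tableau; conversely, flipping all bits along the walk
  of a tableau does not change the image.

  The table is computed by a machine that, after copying \<open>w\<close> to its work tapes, only moves its heads.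
  It enumerates the positions of the five neighbours by nested loops, whereas the finitely many
  tiles are enumerated by its control. Encoding position \<open>p\<close> by the suffix of \<open>w\<close> that starts at \<open>p\<close>
  makes writing a state a matter of copying.
\<close>

section \<open>Structured programs for Turing machines\<close>

datatype com =
    Skip
  | Act "nat list \<Rightarrow> (nat \<times> move) list"
  | Seq com com
  | Cond "nat list \<Rightarrow> bool" com com
  | While "nat list \<Rightarrow> bool" com

inductive exec :: "com \<Rightarrow> tape list \<Rightarrow> nat \<Rightarrow> tape list \<Rightarrow> bool" where
  exec_Skip: "exec Skip s 1 s"
| exec_Act: "exec (Act f) s 1 (map2 act (f (map read_tape s)) s)"
| exec_Seq: "exec c s t s' \<Longrightarrow> exec c' s' t' s'' \<Longrightarrow> exec (Seq c c') s (Suc (t + t')) s''"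
| exec_Cond_True: "b (map read_tape s) \<Longrightarrow> exec c s t s' \<Longrightarrow> exec (Cond b c c') s (Suc t) s'"
| exec_Cond_False: "\<not> b (map read_tape s) \<Longrightarrow> exec c' s t s' \<Longrightarrow> exec (Cond b c c') s (Suc t) s'"
| exec_While_False: "\<not> b (map read_tape s) \<Longrightarrow> exec (While b c) s 1 s"
| exec_While_True: "b (map read_tape s) \<Longrightarrow> exec c s t s' \<Longrightarrow> exec (While b c) s' t' s'' \<Longrightarrow>
    exec (While b c) s (Suc (t + t')) s''"

definition stay :: "nat list \<Rightarrow> (nat \<times> move) list" where
  "stay xs = map (\<lambda>x. (x, Stay)) xs"

text \<open>Tests and sequencing also cost one machine step with unchanged tapes; this is where the
  successors in the times of \<open>exec\<close> come from.\<close>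

fun next_com :: "com list \<Rightarrow> nat list \<Rightarrow> com list \<times> (nat \<times> move) list" where
  "next_com [] xs = ([], stay xs)"
| "next_com (Skip # K) xs = (K, stay xs)"
| "next_com (Act f # K) xs = (K, f xs)"
| "next_com (Seq c c' # K) xs = (c # c' # K, stay xs)"
| "next_com (Cond b c c' # K) xs = ((if b xs then c else c') # K, stay xs)"
| "next_com (While b c # K) xs = (if b xs then c # While b c # K else K, stay xs)"

definition com_step :: "com list \<times> tape list \<Rightarrow> com list \<times> tape list" where
  "com_step = (\<lambda>(K, s). let (K', acts) = next_com K (map read_tape s) in (K', map2 act acts s))"

lemma act_stay [simp]: "map2 act (stay (map read_tape s)) s = s"
  by (induction s) (auto simp: stay_def act_def read_tape_def)

text \<open>The pending stack \<open>K\<close> is arbitrary because the induction runs the first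
  half of a sequence on top of the second half, and a loop body on top of its loop.\<close>

lemma exec_com_step: "exec c s t s' \<Longrightarrow> (com_step ^^ t) (c # K, s) = (K, s')"
proof (induction arbitrary: K rule: exec.induct)
  case (exec_Seq c s t s' c' t' s'')
  then show ?case
    by (subst funpow_Suc_right, subst add.commute, subst funpow_add) (simp add: com_step_def)
next
  case (exec_While_True b s c t s' t' s'')
  then show ?case
    by (subst funpow_Suc_right, subst add.commute, subst funpow_add) (simp add: com_step_def)
qed (auto simp: com_step_def funpow_Suc_right simp del: funpow.simps(2))

text \<open>The stacks that can occur while \<open>c\<close> runs on top of \<open>K\<close>, until
  \<open>K\<close> is exposed. A loop body runs on top of its own loop and then exposes the same
  stack again, so loops do not make stacks grow and the set stays finite.\<close>

fun conts :: "com \<Rightarrow> com list \<Rightarrow> com list set" where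
  "conts Skip K = {Skip # K}"
| "conts (Act f) K = {Act f # K}"
| "conts (Seq c c') K = {Seq c c' # K} \<union> conts c (c' # K) \<union> conts c' K"
| "conts (Cond b c c') K = {Cond b c c' # K} \<union> conts c K \<union> conts c' K"
| "conts (While b c) K = {While b c # K} \<union> conts c (While b c # K)"

lemma finite_conts [simp]: "finite (conts c K)"
  by (induction c arbitrary: K) auto

lemma conts_self [simp]: "c # K \<in> conts c K"
  by (cases c) auto

lemma conts_step: "J \<in> conts c K \<Longrightarrow> fst (next_com J xs) \<in> insert K (conts c K)"
proof (induction c arbitrary: J K)
  case (Seq c c')
  from Seq.prems consider "J = Seq c c' # K" | "J \<in> conts c (c' # K)" | "J \<in> conts c' K" by auto
  then show ?case
  proof cases
    case 2 then show ?thesis using Seq.IH(1)[of J "c' # K"] by auto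
  next
    case 3 then show ?thesis using Seq.IH(2)[of J K] by auto
  qed auto
next
  case (Cond b c c')
  from Cond.prems consider "J = Cond b c c' # K" | "J \<in> conts c K" | "J \<in> conts c' K" by auto
  then show ?case
  proof cases
    case 2 then show ?thesis using Cond.IH(1)[of J K] by auto
  next
    case 3 then show ?thesis using Cond.IH(2)[of J K] by auto
  qed auto
next
  case (While b c)
  from While.prems consider "J = While b c # K" | "J \<in> conts c (While b c # K)" by auto
  then show ?case
  proof cases
    case 2 then show ?thesis using While.IH[of J "While b c # K"] by auto
  qed auto
qed auto

definition wf_acts :: "nat \<Rightarrow> nat \<Rightarrow> (nat \<times> move) list \<Rightarrow> bool" where
  "wf_acts k m acts \<longleftrightarrow> length acts = k \<and> (\<forall>(a, d) \<in> set acts. a < m)"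

fun wf_com :: "nat \<Rightarrow> nat \<Rightarrow> com \<Rightarrow> bool" where
  "wf_com k m Skip = True"
| "wf_com k m (Act f) = (\<forall>xs \<in> tuples {..<m} k. wf_acts k m (f xs))"
| "wf_com k m (Seq c c') = (wf_com k m c \<and> wf_com k m c')"
| "wf_com k m (Cond b c c') = (wf_com k m c \<and> wf_com k m c')"
| "wf_com k m (While b c) = wf_com k m c"

lemma wf_stay: "xs \<in> tuples {..<m} k \<Longrightarrow> wf_acts k m (stay xs)"
  by (auto simp: wf_acts_def stay_def tuples_def)

lemma wf_next_com:
  assumes "wf_com k m c" "J \<in> conts c K" "xs \<in> tuples {..<m} k"
  shows "wf_acts k m (snd (next_com J xs))"
  using assms by (induction c arbitrary: K) (auto simp: wf_stay)

text \<open>The control states of the machine are the finitely many stacks of pending commands.\<close>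

lemma com_to_tm:
  assumes wf: "wf_com k m c" and "k \<ge> 2" "m \<ge> 3"
  obtains M where "wf_tm M"
    "\<And>w t s. exec c ((0, tape_contents w) # replicate (k - 1) (0, tape_contents [])) t s \<Longrightarrow>
       \<exists>q. \<forall>t'\<ge>t. (tm_step M ^^ t') (tm_init M w) = (q, s) \<and> q = tm_halt M"
proof -
  define R where "R = insert [] (conts c [])"
  have finR: "finite R" by (simp add: R_def)
  obtain h where h: "bij_betw h R {0..<card R}"
    using ex_bij_betw_finite_nat[OF finR] by blast
  define g where "g = inv_into R h"
  have gh: "g (h K) = K" if "K \<in> R" for K
    using h that by (simp add: g_def bij_betw_inv_into_left)
  have hR: "h K < card R" if "K \<in> R" for K
    using bij_betwE[OF h] that by auto
  have gR: "g q \<in> R" if "q < card R" for q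
    using h that by (auto simp: g_def bij_betw_def intro: inv_into_into)
  have nR: "fst (next_com K xs) \<in> R" if "K \<in> R" for K xs
    using that conts_step[of K c "[]" xs] by (auto simp: R_def)
  have wfn: "wf_acts k m (snd (next_com K xs))" if "K \<in> R" "xs \<in> tuples {..<m} k" for K xs
    using that wf_next_com[OF wf] by (auto simp: R_def wf_stay)
  define M where "M = \<lparr>tm_tapes = k, tm_symbols = m, tm_states = card R, tm_start = h [c],
    tm_halt = h [], tm_trans = (\<lambda>q xs. map_prod h id (next_com (g q) xs))\<rparr>"
  have R: "[] \<in> R" "[c] \<in> R" by (auto simp: R_def)
  have wfM: "wf_tm M"
    unfolding wf_tm_def
  proof (intro conjI allI impI ballI)
    fix q xs assume q: "q < tm_states M" and xs: "xs \<in> tuples {..<tm_symbols M} (tm_tapes M)"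
    have 1: "g q \<in> R" using q gR by (simp add: M_def)
    have 2: "wf_acts k m (snd (next_com (g q) xs))" using wfn[OF 1] xs by (simp add: M_def)
    show "fst (tm_trans M q xs) < tm_states M" using hR[OF nR[OF 1]] by (simp add: M_def)
    show "length (snd (tm_trans M q xs)) = tm_tapes M" using 2 by (simp add: M_def wf_acts_def)
    show "case z of (a, d) \<Rightarrow> a < tm_symbols M" if "z \<in> set (snd (tm_trans M q xs))" for z
      using 2 that by (auto simp add: M_def wf_acts_def)
  qed (use assms R hR in \<open>auto simp: M_def\<close>)
  \<comment> \<open>At the empty stack both sides idle. At any other stack, injectivity of
    \<open>h\<close> on \<open>R\<close> shows that the machine is not yet in its halting
    state.\<close>
  have step: "tm_step M (h K, s) = map_prod h id (com_step (K, s))" if "K \<in> R" for K s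
  proof (cases "K = []")
    case False
    then have "h K \<noteq> h []" using h that R by (metis gh)
    then show ?thesis using that
      by (simp add: tm_step_def com_step_def M_def gh case_prod_beta)
  qed (simp add: tm_step_def com_step_def M_def)
  have steps: "(tm_step M ^^ t) (h K, s) = map_prod h id ((com_step ^^ t) (K, s)) \<and>
      fst ((com_step ^^ t) (K, s)) \<in> R" if "K \<in> R" for K s t
  proof (induction t)
    case (Suc t)
    obtain K' s' where K': "(com_step ^^ t) (K, s) = (K', s')" by fastforce
    with Suc have "K' \<in> R" by simp
    with Suc K' nR[of K'] show ?case by (simp add: step) (simp add: com_step_def case_prod_beta)
  qed (use that in auto)
  show ?thesis
  proof (rule that[OF wfM])
    fix w t s assume ex: "exec c ((0, tape_contents w) # replicate (k - 1) (0, tape_contents [])) t s"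
    have init: "tm_init M w = (h [c], (0, tape_contents w) # replicate (k - 1) (0, tape_contents []))"
      by (simp add: tm_init_def M_def)
    have t: "(tm_step M ^^ t) (tm_init M w) = (h [], s)"
      using steps[OF R(2)] exec_com_step[OF ex, of "[]"] init by simp
    \<comment> \<open>A halted configuration is a fixed point of \<open>tm_step\<close>, so the
      exact time \<open>t\<close> may be replaced by any upper bound.\<close>
    have "(tm_step M ^^ t') (tm_init M w) = (h [], s)" if "t' \<ge> t" for t'
      using that
    proof (induction t' rule: dec_induct)
      case (step t')
      then show ?case by (simp add: tm_step_def) (simp add: M_def)
    qed (rule t)
    then show "\<exists>q. \<forall>t'\<ge>t. (tm_step M ^^ t') (tm_init M w) = (q, s) \<and> q = tm_halt M"
      by (auto simp: M_def)
  qed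
qed

section \<open>Programs that only move heads and write output\<close>

fun sym :: "bool \<Rightarrow> nat" where
  "sym False = 1"
| "sym True = 2"

text \<open>The first cell carries the symbols \<open>3\<close> and \<open>4\<close> instead of \<open>1\<close> and \<open>2\<close>, so that heads can find it.\<close>

definition marked :: "bool list \<Rightarrow> int \<Rightarrow> nat" where
  "marked w p = (if 0 \<le> p \<and> p < int (length w) then sym (w ! nat p) + (if p = 0 then 2 else 0) else 0)"

text \<open>Tapes \<open>0\<close>, \<open>2\<close>, \<open>3\<close>, \<open>4\<close>,
  \<open>5\<close> will hold the positions of the five cells of the neighbourhood, tape
  \<open>6\<close> counts steps and tape \<open>1\<close> takes the output. Since the work tapes are
  never altered, the head positions and the output so far describe the whole state of a
  program.\<close>

definition heads :: "bool list \<Rightarrow> (nat \<Rightarrow> int) \<Rightarrow> bool list \<Rightarrow> tape list" where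
  "heads w h out =
     map (\<lambda>i. if i = 1 then (int (length out), tape_contents out) else (h i, marked w)) [0..<7]"

definition reads :: "bool list \<Rightarrow> (nat \<Rightarrow> int) \<Rightarrow> nat list" where
  "reads w h = map (\<lambda>i. if i = 1 then 0 else marked w (h i)) [0..<7]"

lemma read_heads: "map read_tape (heads w h out) = reads w h"
  by (auto simp: heads_def reads_def read_tape_def tape_contents_def)

lemma reads_nth: "i < 7 \<Longrightarrow> i \<noteq> 1 \<Longrightarrow> reads w h ! i = marked w (h i)"
  by (simp add: reads_def)

definition Move :: "(nat \<Rightarrow> move) \<Rightarrow> (nat list \<Rightarrow> bool option) \<Rightarrow> com" where
  "Move m e = Act (\<lambda>xs. map (\<lambda>i. if i = 1
      then (case e xs of None \<Rightarrow> (xs ! 1, Stay) | Some b \<Rightarrow> (sym b, MoveRight))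
      else (xs ! i, m i)) [0..<7])"

lemma map2_map_map: "map2 f (map g xs) (map h xs) = map (\<lambda>x. f (g x) (h x)) xs"
  by (induction xs) auto

lemma tape_contents_snoc:
  "(tape_contents out)(int (length out) := sym b) = tape_contents (out @ [b])"
  by (cases b) (auto simp: tape_contents_def fun_eq_iff nth_append)

lemma exec_Move:
  assumes "\<And>i. i < 7 \<Longrightarrow> i \<noteq> 1 \<Longrightarrow> h' i = h i + offset (m i)"
    and "out' = out @ (case e (reads w h) of None \<Rightarrow> [] | Some b \<Rightarrow> [b])"
  shows "exec (Move m e) (heads w h out) 1 (heads w h' out')"
proof -
  have "map2 act (map (\<lambda>i. if i = 1
      then (case e (reads w h) of None \<Rightarrow> (reads w h ! 1, Stay) | Some b \<Rightarrow> (sym b, MoveRight))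
      else (reads w h ! i, m i)) [0..<7]) (heads w h out) = heads w h' out'"
    unfolding heads_def map2_map_map
  proof (rule map_cong[OF refl])
    fix i :: nat assume "i \<in> set [0..<7]"
    then have i: "i < 7" by simp
    show "act (if i = 1
           then case e (reads w h) of None \<Rightarrow> (reads w h ! 1, Stay) | Some b \<Rightarrow> (sym b, MoveRight)
           else (reads w h ! i, m i))
          (if i = 1 then (int (length out), tape_contents out) else (h i, marked w)) =
         (if i = 1 then (int (length out'), tape_contents out') else (h' i, marked w))"
    proof (cases "i = 1")
      case True
      have "reads w h ! 1 = tape_contents out (int (length out))"
        by (simp add: reads_def tape_contents_def)
      with True assms(2) show ?thesis
        by (auto simp: act_def tape_contents_snoc split: option.split)
    next
      case False
      with i assms(1)[of i] show ?thesis by (simp add: act_def reads_nth)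
    qed
  qed
  with exec_Act[of "\<lambda>xs. map (\<lambda>i. if i = 1
      then (case e xs of None \<Rightarrow> (xs ! 1, Stay) | Some b \<Rightarrow> (sym b, MoveRight))
      else (xs ! i, m i)) [0..<7]" "heads w h out"]
  show ?thesis unfolding Move_def read_heads by (simp only:)
qed

section \<open>Upper bounds for running times\<close>

definition run :: "com \<Rightarrow> tape list \<Rightarrow> nat \<Rightarrow> tape list \<Rightarrow> bool" where
  "run c s T s' \<longleftrightarrow> (\<exists>t\<le>T. exec c s t s')"

lemma run_mono: "run c s T s' \<Longrightarrow> T \<le> T' \<Longrightarrow> run c s T' s'"
  unfolding run_def by (meson le_trans)

lemma run_Seq: "run c s T s' \<Longrightarrow> run c' s' T' s'' \<Longrightarrow> run (Seq c c') s (Suc (T + T')) s''"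
  unfolding run_def by (meson exec_Seq add_le_mono Suc_le_mono)

text \<open>Meant for tests whose two branches start with the same clean-up command
  \<open>c\<close>.\<close>

lemma run_Seq_if:
  assumes "run c s T s'" "run (if P then d else d') s' T' s''"
  shows "run (if P then Seq c d else Seq c d') s (Suc (T + T')) s''"
  using assms run_Seq by (cases P) (simp_all only: if_True if_False)

lemma run_Cond:
  "run (if b (map read_tape s) then c else c') s T s' \<Longrightarrow> run (Cond b c c') s (Suc T) s'"
  unfolding run_def by (auto split: if_splits intro: exec_Cond_True exec_Cond_False)

text \<open>The states between the rounds are given by an explicit sequence \<open>s\<close>; this
  takes the place of a loop invariant.\<close>

lemma run_While:
  assumes "\<And>k. k < n \<Longrightarrow> b (map read_tape (s k))" "\<not> b (map read_tape (s n))"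
    and "\<And>k. k < n \<Longrightarrow> run c (s k) T (s (Suc k))"
  shows "run (While b c) (s 0) (n * Suc T + 1) (s n)"
  using assms
proof (induction n arbitrary: s)
  case 0
  then show ?case unfolding run_def using exec_While_False[of b "s 0" c] by auto
next
  case (Suc n)
  have "run (While b c) (s 1) (n * Suc T + 1) (s (Suc n))"
    using Suc.IH[of "\<lambda>k. s (Suc k)"] Suc.prems by simp
  moreover have "run c (s 0) T (s 1)" "b (map read_tape (s 0))" using Suc.prems by auto
  ultimately obtain t t' where t: "exec c (s 0) t (s 1)" "t \<le> T"
      "exec (While b c) (s 1) t' (s (Suc n))" "t' \<le> n * Suc T + 1" "b (map read_tape (s 0))"
    unfolding run_def by blast
  have "exec (While b c) (s 0) (Suc (t + t')) (s (Suc n))"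
    using t by (blast intro: exec_While_True)
  moreover have "Suc (t + t') \<le> Suc n * Suc T + 1" using t by simp
  ultimately show ?case unfolding run_def by blast
qed

lemma run_Move:
  assumes "\<And>i. i < 7 \<Longrightarrow> i \<noteq> 1 \<Longrightarrow> h' i = h i + offset (m i)"
    and "out' = out @ (case e (reads w h) of None \<Rightarrow> [] | Some b \<Rightarrow> [b])"
  shows "run (Move m e) (heads w h out) 1 (heads w h' out')"
  unfolding run_def by (intro exI[of _ 1] conjI exec_Move assms) auto

section \<open>Polynomially bounded running times\<close>

definition poly_bounded :: "(nat \<Rightarrow> nat) \<Rightarrow> bool" where
  "poly_bounded T \<longleftrightarrow> (\<exists>c k. \<forall>n. T n \<le> c + c * n ^ k)"

lemma poly_bounded_const: "poly_bounded (\<lambda>n. a)"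
  unfolding poly_bounded_def by (rule exI[of _ a]) auto

lemma poly_bounded_id: "poly_bounded (\<lambda>n. n)"
  unfolding poly_bounded_def by (rule exI[of _ 1], rule exI[of _ 1]) auto

text \<open>Powers of \<open>Suc n\<close> are at least 1 and grow with the exponent, also for
  \<open>n = 0\<close>. In this form bounds can be added and multiplied without case
  distinctions.\<close>

lemma poly_bounded_iff: "poly_bounded T \<longleftrightarrow> (\<exists>c k. \<forall>n. T n \<le> c * Suc n ^ k)"
proof
  assume "poly_bounded T"
  then obtain c k where *: "T n \<le> c + c * n ^ k" for n unfolding poly_bounded_def by blast
  have "T n \<le> (2 * c) * Suc n ^ k" for n
  proof -
    have "n ^ k \<le> Suc n ^ k" "1 \<le> Suc n ^ k" by (auto intro: power_mono)
    then have "c * 1 + c * n ^ k \<le> c * Suc n ^ k + c * Suc n ^ k"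
      by (intro add_mono mult_le_mono2)
    with *[of n] show ?thesis by simp
  qed
  then show "\<exists>c k. \<forall>n. T n \<le> c * Suc n ^ k" by blast
next
  assume "\<exists>c k. \<forall>n. T n \<le> c * Suc n ^ k"
  then obtain c k where *: "T n \<le> c * Suc n ^ k" for n by blast
  \<comment> \<open>The factor \<open>2 ^ k\<close> stems from \<open>Suc n \<le> 2 * n\<close> for
    positive \<open>n\<close>.\<close>
  have "T n \<le> c * 2 ^ k + c * 2 ^ k * n ^ k" for n
  proof (cases "n = 0")
    case True
    have "c \<le> c * 2 ^ k" by simp
    with True *[of n] show ?thesis by (simp add: trans_le_add1 order_trans)
  next
    case False
    then have "Suc n ^ k \<le> (2 * n) ^ k" by (intro power_mono) auto
    then have "c * Suc n ^ k \<le> c * (2 ^ k * n ^ k)" by (simp add: power_mult_distrib)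
    with *[of n] show ?thesis by (simp add: mult.assoc trans_le_add2 order_trans)
  qed
  then show "poly_bounded T" unfolding poly_bounded_def by blast
qed

lemma poly_bounded_add:
  assumes "poly_bounded T" "poly_bounded T'"
  shows "poly_bounded (\<lambda>n. T n + T' n)"
proof -
  obtain c k c' k' where *: "T n \<le> c * Suc n ^ k" "T' n \<le> c' * Suc n ^ k'" for n
    using assms unfolding poly_bounded_iff by blast
  have "T n + T' n \<le> (c + c') * Suc n ^ (k + k')" for n
  proof -
    have "Suc n ^ k \<le> Suc n ^ (k + k')" "Suc n ^ k' \<le> Suc n ^ (k + k')"
      by (auto intro: power_increasing)
    then have "c * Suc n ^ k + c' * Suc n ^ k' \<le> c * Suc n ^ (k + k') + c' * Suc n ^ (k + k')"
      by (intro add_mono mult_le_mono2)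
    with *[of n] show ?thesis by (simp add: add_mult_distrib)
  qed
  then show ?thesis unfolding poly_bounded_iff by blast
qed

lemma poly_bounded_mult:
  assumes "poly_bounded T" "poly_bounded T'"
  shows "poly_bounded (\<lambda>n. T n * T' n)"
proof -
  obtain c k c' k' where *: "T n \<le> c * Suc n ^ k" "T' n \<le> c' * Suc n ^ k'" for n
    using assms unfolding poly_bounded_iff by blast
  have "T n * T' n \<le> (c * c') * Suc n ^ (k + k')" for n
    using mult_le_mono[OF *(1)[of n] *(2)[of n]] by (simp add: power_add ac_simps)
  then show ?thesis unfolding poly_bounded_iff by blast
qed

lemmas poly_bounded_intros =
  poly_bounded_const poly_bounded_id poly_bounded_add poly_bounded_mult

text \<open>Tape \<open>6\<close> serves as a step counter that is back at \<open>0\<close> between commands.\<close>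

definition in_range :: "bool list \<Rightarrow> (nat \<Rightarrow> int) \<Rightarrow> bool" where
  "in_range w h \<longleftrightarrow> w \<noteq> [] \<and> h 6 = 0 \<and> (\<forall>i. 0 \<le> h i \<and> h i \<le> int (length w))"

text \<open>A program is specified by the string it appends to the output. It has to put all heads
  back, so that programs compose like string-valued functions of the same head positions. The time
  bound depends on \<open>length w\<close> only.\<close>

definition emits ::
    "(bool list \<Rightarrow> (nat \<Rightarrow> int) \<Rightarrow> bool) \<Rightarrow> com \<Rightarrow> (bool list \<Rightarrow> (nat \<Rightarrow> int) \<Rightarrow> bool list) \<Rightarrow> bool" where
  "emits P c g \<longleftrightarrow> (\<exists>T. poly_bounded T \<and>
     (\<forall>w h out. in_range w h \<longrightarrow> P w h \<longrightarrow>
        run c (heads w h out) (T (length w)) (heads w h (out @ g w h))))"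

lemma emitsI:
  assumes "poly_bounded T"
    and "\<And>w h out. in_range w h \<Longrightarrow> P w h \<Longrightarrow>
      run c (heads w h out) (T (length w)) (heads w h (out @ g w h))"
  shows "emits P c g"
  using assms unfolding emits_def by blast

lemma emits_conv:
  assumes "emits P c g" "\<And>w h. in_range w h \<Longrightarrow> Q w h \<Longrightarrow> P w h \<and> g w h = g' w h"
  shows "emits Q c g'"
  using assms unfolding emits_def by metis

lemma emits_Skip: "emits P Skip (\<lambda>w h. [])"
  by (rule emitsI[OF poly_bounded_const[of 1]]) (unfold run_def append_Nil2, blast intro: exec_Skip)

lemma emits_Seq:
  assumes "emits P c g" "emits P c' g'"
  shows "emits P (Seq c c') (\<lambda>w h. g w h @ g' w h)"
proof -
  obtain T T' where T: "poly_bounded T" "poly_bounded T'"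
    and r: "\<And>w h out. in_range w h \<Longrightarrow> P w h \<Longrightarrow>
        run c (heads w h out) (T (length w)) (heads w h (out @ g w h))"
      "\<And>w h out. in_range w h \<Longrightarrow> P w h \<Longrightarrow>
        run c' (heads w h out) (T' (length w)) (heads w h (out @ g' w h))"
    using assms unfolding emits_def by blast
  show ?thesis
  proof (rule emitsI)
    show "poly_bounded (\<lambda>n. 1 + (T n + T' n))" by (intro poly_bounded_intros T)
  qed (use run_Seq[OF r(1) r(2)] in simp)
qed

lemma emits_Cond:
  assumes "emits P c g" "emits P c' g'"
  shows "emits P (Cond b c c') (\<lambda>w h. if b (reads w h) then g w h else g' w h)"
proof -
  obtain T T' where T: "poly_bounded T" "poly_bounded T'"
    and r: "\<And>w h out. in_range w h \<Longrightarrow> P w h \<Longrightarrow>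
        run c (heads w h out) (T (length w)) (heads w h (out @ g w h))"
      "\<And>w h out. in_range w h \<Longrightarrow> P w h \<Longrightarrow>
        run c' (heads w h out) (T' (length w)) (heads w h (out @ g' w h))"
    using assms unfolding emits_def by blast
  show ?thesis
  proof (rule emitsI)
    show "poly_bounded (\<lambda>n. 1 + (T n + T' n))" by (intro poly_bounded_intros T)
    fix w h out assume h: "in_range w h" "P w h"
    show "run (Cond b c c') (heads w h out) (1 + (T (length w) + T' (length w)))
       (heads w h (out @ (if b (reads w h) then g w h else g' w h)))"
      unfolding plus_1_eq_Suc
      by (rule run_Cond) (auto simp: read_heads intro: run_mono[OF r(1)[OF h]] run_mono[OF r(2)[OF h]])
  qed
qed

fun seqs :: "com list \<Rightarrow> com" where
  "seqs [] = Skip"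
| "seqs (c # cs) = Seq c (seqs cs)"

lemma emits_seqs:
  assumes "\<And>x. x \<in> set xs \<Longrightarrow> emits P (c x) (g x)"
  shows "emits P (seqs (map c xs)) (\<lambda>w h. concat (map (\<lambda>x. g x w h) xs))"
  using assms by (induction xs) (auto intro: emits_Skip emits_Seq)

section \<open>Printing, copying, comparing and looping over positions\<close>

definition Print :: "bool list \<Rightarrow> com" where
  "Print bs = seqs (map (\<lambda>b. Move (\<lambda>_. Stay) (\<lambda>_. Some b)) bs)"

lemma emits_Print: "emits P (Print bs) (\<lambda>_ _. bs)"
proof -
  have "emits P (Move (\<lambda>_. Stay) (\<lambda>_. Some b)) (\<lambda>_ _. [b])" for b
    by (rule emitsI[OF poly_bounded_const[of 1]], rule run_Move) auto
  then have "emits P (Print bs) (\<lambda>_ _. concat (map (\<lambda>b. [b]) bs))"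
    unfolding Print_def by (intro emits_seqs)
  then show ?thesis by simp
qed

lemma marked_eq_0: "0 \<le> p \<Longrightarrow> marked w p = 0 \<longleftrightarrow> int (length w) \<le> p"
  by (cases "w ! nat p") (auto simp: marked_def)

lemma marked_less_3: "w \<noteq> [] \<Longrightarrow> 0 \<le> p \<Longrightarrow> marked w p < 3 \<longleftrightarrow> p \<noteq> 0"
  by (cases "w ! nat p") (auto simp: marked_def)

lemma marked_less_5: "marked w p < 5"
  by (cases "w ! nat p") (auto simp: marked_def)

definition shift :: "nat set \<Rightarrow> int \<Rightarrow> (nat \<Rightarrow> int) \<Rightarrow> nat \<Rightarrow> int" where
  "shift I d h = (\<lambda>i. if i \<in> I then h i + d else h i)"

lemma shift_0 [simp]: "shift I 0 h = h"
  by (auto simp: shift_def)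

lemma shift_shift [simp]: "shift I d (shift I d' h) = shift I (d + d') h"
  by (auto simp: shift_def)

definition moves :: "nat set \<Rightarrow> move \<Rightarrow> (nat \<Rightarrow> move)" where
  "moves I m = (\<lambda>i. if i \<in> I then m else Stay)"

lemma run_shift:
  "d' = d + offset m \<Longrightarrow> run (Move (moves I m) (\<lambda>_. None)) (heads w (shift I d h) out) 1 (heads w (shift I d' h) out)"
  by (rule run_Move) (auto simp: moves_def shift_def)

text \<open>Head \<open>6\<close> starts at \<open>0\<close> and takes part in every common move to
  the right, so it reaches the marked first cell exactly when the move of all heads in
  \<open>I\<close> has been undone.\<close>

definition Return :: "nat set \<Rightarrow> com" where
  "Return I = While (\<lambda>xs. xs ! 6 < 3) (Move (moves I MoveLeft) (\<lambda>_. None))"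

lemma run_Return:
  assumes "in_range w h" "6 \<in> I"
  shows "run (Return I) (heads w (shift I (int n) h) out) (2 * n + 1) (heads w h out)"
proof -
  have "run (Return I) (heads w (shift I (int n - int 0) h) out) (n * Suc 1 + 1)
      (heads w (shift I (int n - int n) h) out)"
    unfolding Return_def
  proof (rule run_While[where s = "\<lambda>k. heads w (shift I (int n - int k) h) out"])
    fix k assume "k < n"
    then show "run (Move (moves I MoveLeft) (\<lambda>_. None)) (heads w (shift I (int n - int k) h) out) 1
        (heads w (shift I (int n - int (Suc k)) h) out)"
      by (intro run_shift) auto
  qed (use assms in \<open>auto simp: read_heads reads_nth marked_less_3 in_range_def shift_def\<close>)
  then show ?thesis by (simp add: mult_2 mult_2_right)
qed

text \<open>The symbols \<open>2\<close> and \<open>4\<close> stand for a true bit, in an ordinary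
  cell and in the marked first cell.\<close>

definition Suffix :: "nat \<Rightarrow> com" where
  "Suffix i = Seq
     (While (\<lambda>xs. xs ! i \<noteq> 0) (Seq (Move (\<lambda>_. Stay) (\<lambda>_. Some True))
        (Move (moves {i, 6} MoveRight) (\<lambda>xs. Some (xs ! i \<in> {2, 4})))))
     (Return {i, 6})"

text \<open>\<open>enc_bits\<close> without its end mark. As it commutes with concatenation, a
  string can be printed in pieces.\<close>

definition spread :: "bool list \<Rightarrow> bool list" where
  "spread bs = concat (map (\<lambda>b. [True, b]) bs)"

lemma enc_bits_spread: "enc_bits bs = spread bs @ [False]"
  by (simp add: enc_bits_def enc_list_def spread_def)

lemma emits_Suffix:
  assumes i: "i < 7" "i \<noteq> 1" "i \<noteq> 6"
  shows "emits P (Suffix i) (\<lambda>w h. spread (drop (nat (h i)) w))"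
proof (rule emitsI)
  show "poly_bounded (\<lambda>n. 1 + ((n * 4 + 1) + (2 * n + 1)))" by (intro poly_bounded_intros)
  fix w h out assume h: "in_range w h"
  define p where "p = nat (h i)"
  define n where "n = length w - p"
  have p: "h i = int p" "p \<le> length w" using h i by (auto simp: p_def in_range_def nat_le_iff)
  then have n: "n \<le> length w" "p + n = length w" by (auto simp: n_def)
  define s where "s k = heads w (shift {i, 6} (int k) h) (out @ spread (take k (drop p w)))" for k
  have "run (While (\<lambda>xs. xs ! i \<noteq> 0) (Seq (Move (\<lambda>_. Stay) (\<lambda>_. Some True))
        (Move (moves {i, 6} MoveRight) (\<lambda>xs. Some (xs ! i \<in> {2, 4}))))) (s 0) (n * Suc 3 + 1) (s n)"
  proof (rule run_While)
    fix k assume k: "k < n"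
    then show "map read_tape (s k) ! i \<noteq> 0"
      using i p n by (simp add: s_def read_heads reads_nth shift_def marked_eq_0)
    let ?out = "out @ spread (take k (drop p w)) @ [True]"
    have "sym (w ! (p + k)) \<in> {2, 4} \<longleftrightarrow> w ! (p + k)"
      "sym (w ! (p + k)) + 2 \<in> {2, 4} \<longleftrightarrow> w ! (p + k)"
      by (cases "w ! (p + k)"; simp)+
    then have "marked w (int p + int k) \<in> {2, 4} \<longleftrightarrow> w ! (p + k)"
      using k n by (auto simp: marked_def nat_add_distrib)
    moreover have "spread (take (Suc k) (drop p w)) = spread (take k (drop p w)) @ [True, w ! (p + k)]"
      using k n by (simp add: spread_def take_Suc_conv_app_nth)
    ultimately have "run (Seq (Move (\<lambda>_. Stay) (\<lambda>_. Some True))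
        (Move (moves {i, 6} MoveRight) (\<lambda>xs. Some (xs ! i \<in> {2, 4}))))
        (s k) (Suc (1 + 1)) (s (Suc k))"
      unfolding s_def using i p
      by (intro run_Seq[where s' = "heads w (shift {i, 6} (int k) h) ?out"] run_Move)
         (auto simp: moves_def shift_def reads_nth)
    then show "run (Seq (Move (\<lambda>_. Stay) (\<lambda>_. Some True))
        (Move (moves {i, 6} MoveRight) (\<lambda>xs. Some (xs ! i \<in> {2, 4})))) (s k) 3 (s (Suc k))"
      by (simp add: eval_nat_numeral)
  qed (use i p n in \<open>simp add: s_def read_heads reads_nth shift_def marked_eq_0\<close>)
  moreover have "run (Return {i, 6}) (s n) (2 * n + 1) (heads w h (out @ spread (drop p w)))"
    using run_Return[OF h, of "{i, 6}" n] n(2) by (simp add: s_def)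
  ultimately have "run (Suffix i) (s 0) (Suc (n * Suc 3 + 1 + (2 * n + 1))) (heads w h (out @ spread (drop p w)))"
    unfolding Suffix_def by (rule run_Seq)
  then show "run (Suffix i) (heads w h out)
      (1 + ((length w * 4 + 1) + (2 * length w + 1))) (heads w h (out @ spread (drop (nat (h i)) w)))"
    using n(1) by (auto simp: s_def p_def spread_def elim!: run_mono)
qed

text \<open>Both heads move right in parallel until one of them reads the blank behind the input.
  They started at the same position iff both read it at that moment.\<close>

definition Equal :: "nat \<Rightarrow> nat \<Rightarrow> com \<Rightarrow> com \<Rightarrow> com" where
  "Equal i j c c' = Seq
     (While (\<lambda>xs. xs ! i \<noteq> 0 \<and> xs ! j \<noteq> 0) (Move (moves {i, j, 6} MoveRight) (\<lambda>_. None)))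
     (Cond (\<lambda>xs. xs ! i = 0 \<and> xs ! j = 0)
        (Seq (Return {i, j, 6}) c) (Seq (Return {i, j, 6}) c'))"

lemma run_Equal:
  assumes h: "in_range w h" and i: "i < 7" "i \<noteq> 1" "i \<noteq> 6" and j: "j < 7" "j \<noteq> 1" "j \<noteq> 6"
    and r: "run (if h i = h j then c else c') (heads w h out) T s'"
  shows "run (Equal i j c c') (heads w h out) (T + 4 * length w + 5) s'"
proof -
  \<comment> \<open>The head that is further to the right reaches the blank first, after this many
    moves.\<close>
  define n where "n = nat (int (length w) - max (h i) (h j))"
  have b: "0 \<le> h i" "0 \<le> h j" "h i \<le> int (length w)" "h j \<le> int (length w)"
    using h by (auto simp: in_range_def)
  then have n: "int n = int (length w) - max (h i) (h j)" by (auto simp: n_def)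
  then have n': "n \<le> length w" using b by linarith
  define s where "s k = heads w (shift {i, j, 6} (int k) h) out" for k
  have rd: "map read_tape (s k) ! i = 0 \<longleftrightarrow> int (length w) \<le> h i + int k"
      "map read_tape (s k) ! j = 0 \<longleftrightarrow> int (length w) \<le> h j + int k" for k
    using i j b by (auto simp: s_def read_heads reads_nth shift_def marked_eq_0)
  have "run (While (\<lambda>xs. xs ! i \<noteq> 0 \<and> xs ! j \<noteq> 0) (Move (moves {i, j, 6} MoveRight) (\<lambda>_. None)))
      (s 0) (n * Suc 1 + 1) (s n)"
  proof (rule run_While)
    fix k
    show "run (Move (moves {i, j, 6} MoveRight) (\<lambda>_. None)) (s k) 1 (s (Suc k))"
      unfolding s_def by (rule run_shift) simp
  qed (use n in \<open>auto simp: rd\<close>)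
  moreover have "run (Cond (\<lambda>xs. xs ! i = 0 \<and> xs ! j = 0)
        (Seq (Return {i, j, 6}) c) (Seq (Return {i, j, 6}) c')) (s n) (Suc (Suc (2 * n + 1 + T))) s'"
  proof (rule run_Cond)
    have "(map read_tape (s n) ! i = 0 \<and> map read_tape (s n) ! j = 0) \<longleftrightarrow> h i = h j"
      using n by (auto simp: rd)
    moreover have "run (Return {i, j, 6}) (s n) (2 * n + 1) (heads w h out)"
      unfolding s_def by (rule run_Return[OF h]) simp
    ultimately show "run (if map read_tape (s n) ! i = 0 \<and> map read_tape (s n) ! j = 0
        then Seq (Return {i, j, 6}) c else Seq (Return {i, j, 6}) c') (s n) (Suc (2 * n + 1 + T)) s'"
      using run_Seq_if[OF _ r] by (simp only:)
  qed
  ultimately have "run (Equal i j c c') (s 0) (Suc (n * Suc 1 + 1 + Suc (Suc (2 * n + 1 + T)))) s'"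
    unfolding Equal_def by (rule run_Seq)
  then show ?thesis using n' by (auto simp: s_def elim!: run_mono)
qed

lemma emits_Equal:
  assumes c: "emits P c g" "emits P c' g'" and i: "i < 7" "i \<noteq> 1" "i \<noteq> 6" and j: "j < 7" "j \<noteq> 1" "j \<noteq> 6"
  shows "emits P (Equal i j c c') (\<lambda>w h. if h i = h j then g w h else g' w h)"
proof -
  obtain T T' where T: "poly_bounded T" "poly_bounded T'"
    and r: "\<And>w h out. in_range w h \<Longrightarrow> P w h \<Longrightarrow>
        run c (heads w h out) (T (length w)) (heads w h (out @ g w h))"
      "\<And>w h out. in_range w h \<Longrightarrow> P w h \<Longrightarrow>
        run c' (heads w h out) (T' (length w)) (heads w h (out @ g' w h))"
    using c unfolding emits_def by blast
  show ?thesis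
  proof (rule emitsI)
    show "poly_bounded (\<lambda>n. (T n + T' n) + 4 * n + 5)" by (intro poly_bounded_intros T)
    fix w h out assume h: "in_range w h" "P w h"
    show "run (Equal i j c c') (heads w h out) (T (length w) + T' (length w) + 4 * length w + 5)
        (heads w h (out @ (if h i = h j then g w h else g' w h)))"
      by (rule run_Equal[OF h(1) i j])
         (auto intro: run_mono[OF r(1)[OF h]] run_mono[OF r(2)[OF h]])
  qed
qed

text \<open>A head on the blank behind the input is at the last admissible position, which has no
  successor; the answer is then negative at once. Otherwise head \<open>i\<close> can advance for
  the comparison without leaving the range, and each branch first moves it back.\<close>

definition Succ :: "nat \<Rightarrow> nat \<Rightarrow> com \<Rightarrow> com \<Rightarrow> com" where
  "Succ i j c c' = Cond (\<lambda>xs. xs ! i = 0) c'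
     (Seq (Move (moves {i} MoveRight) (\<lambda>_. None))
        (Equal i j (Seq (Move (moves {i} MoveLeft) (\<lambda>_. None)) c)
           (Seq (Move (moves {i} MoveLeft) (\<lambda>_. None)) c')))"

lemma emits_Succ:
  assumes c: "emits P c g" "emits P c' g'" and i: "i < 7" "i \<noteq> 1" "i \<noteq> 6" and j: "j < 7" "j \<noteq> 1" "j \<noteq> 6"
    and ij: "i \<noteq> j"
  shows "emits P (Succ i j c c') (\<lambda>w h. if h j = h i + 1 then g w h else g' w h)"
proof -
  obtain T T' where T: "poly_bounded T" "poly_bounded T'"
    and r: "\<And>w h out. in_range w h \<Longrightarrow> P w h \<Longrightarrow>
        run c (heads w h out) (T (length w)) (heads w h (out @ g w h))"
      "\<And>w h out. in_range w h \<Longrightarrow> P w h \<Longrightarrow>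
        run c' (heads w h out) (T' (length w)) (heads w h (out @ g' w h))"
    using c unfolding emits_def by blast
  let ?S = "\<lambda>n. T n + T' n"
  show ?thesis
  proof (rule emitsI)
    show "poly_bounded (\<lambda>n. (T n + T' n) + 4 * n + 10)" by (intro poly_bounded_intros T)
    fix w h out assume h: "in_range w h" "P w h"
    let ?s = "heads w h (out @ (if h j = h i + 1 then g w h else g' w h))"
    let ?c = "Seq (Move (moves {i} MoveLeft) (\<lambda>_. None)) c"
    let ?c' = "Seq (Move (moves {i} MoveLeft) (\<lambda>_. None)) c'"
    have b: "0 \<le> h i" "h j \<le> int (length w)" using h by (auto simp: in_range_def)
    have at_end: "reads w h ! i = 0 \<longleftrightarrow> int (length w) \<le> h i"
      using i b by (simp add: reads_nth marked_eq_0)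
    have "run (if reads w h ! i = 0 then c' else Seq (Move (moves {i} MoveRight) (\<lambda>_. None)) (Equal i j ?c ?c'))
        (heads w h out) (Suc (1 + (Suc (1 + ?S (length w)) + 4 * length w + 5))) ?s"
    proof (cases "reads w h ! i = 0")
      case True
      then show ?thesis using b at_end by (auto intro: run_mono[OF r(2)[OF h]])
    next
      case False
      let ?h = "shift {i} 1 h"
      have h': "in_range w ?h" using h(1) False i at_end by (auto simp: in_range_def shift_def)
      have ret: "run (Move (moves {i} MoveLeft) (\<lambda>_. None)) (heads w ?h out) 1 (heads w h out)"
        using run_shift[of 0 1 MoveLeft "{i}" w h out] by simp
      have *: "?h i = ?h j \<longleftrightarrow> h j = h i + 1" using ij by (auto simp: shift_def)
      have "run (if h j = h i + 1 then c else c') (heads w h out) (?S (length w)) ?s"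
        by (auto intro: run_mono[OF r(1)[OF h]] run_mono[OF r(2)[OF h]])
      then have "run (if ?h i = ?h j then ?c else ?c') (heads w ?h out) (Suc (1 + ?S (length w))) ?s"
        unfolding * by (rule run_Seq_if[OF ret])
      from run_Equal[OF h' i j this] have "run (Equal i j ?c ?c') (heads w ?h out)
          (Suc (1 + ?S (length w)) + 4 * length w + 5) ?s" .
      moreover have "run (Move (moves {i} MoveRight) (\<lambda>_. None)) (heads w h out) 1 (heads w ?h out)"
        using run_shift[of 1 0 MoveRight "{i}" w h out] by simp
      ultimately show ?thesis using False by (simp only: if_False) (rule run_Seq)
    qed
    then have "run (Succ i j c c') (heads w h out) (Suc (Suc (1 + (Suc (1 + ?S (length w)) + 4 * length w + 5)))) ?s"
      unfolding Succ_def by (intro run_Cond) (simp add: read_heads)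
    then show "run (Succ i j c c') (heads w h out) (?S (length w) + 4 * length w + 10) ?s"
      by (rule run_mono) simp
  qed
qed

fun Case :: "nat \<Rightarrow> nat \<Rightarrow> (nat \<Rightarrow> com) \<Rightarrow> com" where
  "Case i 0 c = Skip"
| "Case i (Suc n) c = Cond (\<lambda>xs. xs ! i = n) (c n) (Case i n c)"

lemma emits_Case:
  assumes "\<And>a. a < n \<Longrightarrow> emits P (c a) (g a)" "i < 7" "i \<noteq> 1"
  shows "emits P (Case i n c) (\<lambda>w h. if marked w (h i) < n then g (marked w (h i)) w h else [])"
  using assms(1)
proof (induction n)
  case 0
  then show ?case by (simp add: emits_Skip)
next
  case (Suc n)
  have "emits P (Case i (Suc n) c) (\<lambda>w h. if reads w h ! i = n then g n w h else
      if marked w (h i) < n then g (marked w (h i)) w h else [])"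
    unfolding Case.simps by (rule emits_Cond) (use Suc in auto)
  then show ?case by (rule emits_conv) (use assms in \<open>auto simp: reads_nth less_Suc_eq\<close>)
qed

text \<open>The body runs once before the loop and once after each move, hence also on the blank
  behind the input. This gives \<open>length w + 1\<close> rounds, one for each suffix of
  \<open>w\<close> including the empty one.\<close>

definition For :: "nat \<Rightarrow> com \<Rightarrow> com" where
  "For i c = Seq c (Seq
     (While (\<lambda>xs. xs ! i \<noteq> 0) (Seq (Move (moves {i} MoveRight) (\<lambda>_. None)) c))
     (While (\<lambda>xs. xs ! i < 3) (Move (moves {i} MoveLeft) (\<lambda>_. None))))"

lemma emits_For:
  assumes c: "emits P c g" and i: "i < 7" "i \<noteq> 1" "i \<noteq> 6"
    and Q: "\<And>w h. in_range w h \<Longrightarrow> Q w h \<Longrightarrow> h i = 0"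
      "\<And>w h p. in_range w h \<Longrightarrow> Q w h \<Longrightarrow> p \<le> length w \<Longrightarrow> P w (h(i := int p))"
  shows "emits Q (For i c) (\<lambda>w h. concat (map (\<lambda>p. g w (h(i := int p))) [0..<Suc (length w)]))"
proof -
  obtain T where T: "poly_bounded T"
    and r: "\<And>w h out. in_range w h \<Longrightarrow> P w h \<Longrightarrow>
        run c (heads w h out) (T (length w)) (heads w h (out @ g w h))"
    using c unfolding emits_def by blast
  let ?B = "\<lambda>n. 1 + (T n + (1 + ((n * (1 + (1 + (1 + T n))) + 1) + (n * 2 + 1))))"
  show ?thesis
  proof (rule emitsI)
    show "poly_bounded ?B" by (intro poly_bounded_intros T)
    fix w h out assume h: "in_range w h" "Q w h"
    let ?L = "length w"
    define out' where "out' k = out @ concat (map (\<lambda>p. g w (h(i := int p))) [0..<Suc k])" for k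
    define s where "s k = heads w (h(i := int k)) (out' k)" for k
    have rp: "in_range w (h(i := int p))" "P w (h(i := int p))" if "p \<le> ?L" for p
      using h i Q(2)[OF h that] that by (auto simp: in_range_def)
    have h0: "h(i := 0) = h" using Q(1)[OF h] by auto
    have 1: "run c (heads w h out) (T ?L) (s 0)"
      using r[OF rp, of 0 out] by (simp add: s_def out'_def h0)
    have 2: "run (While (\<lambda>xs. xs ! i \<noteq> 0) (Seq (Move (moves {i} MoveRight) (\<lambda>_. None)) c))
        (s 0) (?L * Suc (Suc (1 + T ?L)) + 1) (s ?L)"
    proof (rule run_While)
      fix k assume k: "k < ?L"
      have "run (Move (moves {i} MoveRight) (\<lambda>_. None)) (s k) 1 (heads w (h(i := int (Suc k))) (out' k))"
        unfolding s_def by (rule run_Move) (auto simp: moves_def)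
      moreover have "run c (heads w (h(i := int (Suc k))) (out' k)) (T ?L) (s (Suc k))"
        using r[OF rp, of "Suc k" "out' k"] k by (simp add: s_def out'_def)
      ultimately show "run (Seq (Move (moves {i} MoveRight) (\<lambda>_. None)) c) (s k) (Suc (1 + T ?L)) (s (Suc k))"
        by (rule run_Seq)
    qed (use i in \<open>auto simp: s_def read_heads reads_nth marked_eq_0\<close>)
    have "run (While (\<lambda>xs. xs ! i < 3) (Move (moves {i} MoveLeft) (\<lambda>_. None)))
        (heads w (h(i := int ?L - int 0)) (out' ?L)) (?L * Suc 1 + 1) (heads w (h(i := int ?L - int ?L)) (out' ?L))"
    proof (rule run_While[where s = "\<lambda>k. heads w (h(i := int ?L - int k)) (out' ?L)"])
      fix k
      show "run (Move (moves {i} MoveLeft) (\<lambda>_. None)) (heads w (h(i := int ?L - int k)) (out' ?L)) 1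
         (heads w (h(i := int ?L - int (Suc k))) (out' ?L))"
        by (rule run_Move) (auto simp: moves_def)
    qed (use i h in \<open>auto simp: read_heads reads_nth marked_less_3 in_range_def\<close>)
    then have 3: "run (While (\<lambda>xs. xs ! i < 3) (Move (moves {i} MoveLeft) (\<lambda>_. None)))
        (s ?L) (?L * Suc 1 + 1) (heads w h (out' ?L))"
      by (simp add: s_def h0)
    from run_Seq[OF 1 run_Seq[OF 2 3]]
    show "run (For i c) (heads w h out) (?B ?L)
        (heads w h (out @ concat (map (\<lambda>p. g w (h(i := int p))) [0..<Suc ?L])))"
      unfolding For_def out'_def by (rule run_mono) simp
  qed
qed

section \<open>Loading the input\<close>

lemma tuples_nth_less: "xs \<in> tuples {..<m} k \<Longrightarrow> i < k \<Longrightarrow> xs ! i < m"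
  unfolding tuples_def by (metis (mono_tags, lifting) lessThan_iff mem_Collect_eq nth_mem subsetD)

lemma wf_Move: "wf_com 7 5 (Move m e)"
proof -
  have "sym b < 5" for b by (cases b) auto
  then show ?thesis
    by (auto simp: Move_def wf_acts_def tuples_nth_less split: option.split)
qed

lemma wf_seqs: "(\<And>c. c \<in> set cs \<Longrightarrow> wf_com k m c) \<Longrightarrow> wf_com k m (seqs cs)"
  by (induction cs) auto

lemma wf_Print: "wf_com 7 5 (Print bs)"
  unfolding Print_def by (rule wf_seqs) (auto simp: wf_Move)

lemma wf_Suffix: "wf_com 7 5 (Suffix i)"
  by (simp add: Suffix_def Return_def wf_Move)

lemma wf_Equal: "wf_com 7 5 c \<Longrightarrow> wf_com 7 5 c' \<Longrightarrow> wf_com 7 5 (Equal i j c c')"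
  by (simp add: Equal_def Return_def wf_Move)

lemma wf_Succ: "wf_com 7 5 c \<Longrightarrow> wf_com 7 5 c' \<Longrightarrow> wf_com 7 5 (Succ i j c c')"
  by (simp add: Succ_def wf_Equal wf_Move)

lemma wf_Case: "(\<And>a. wf_com k m (c a)) \<Longrightarrow> wf_com k m (Case i n c)"
  by (induction n) auto

lemma wf_For: "wf_com 7 5 c \<Longrightarrow> wf_com 7 5 (For i c)"
  by (simp add: For_def wf_Move)

text \<open>The first action treats the first cell, whose copies get the marks \<open>3\<close> and
  \<open>4\<close>; on tape \<open>0\<close> it overwrites the input symbol. All work heads move
  together, so looking at tape \<open>0\<close> suffices to stop both loops.\<close>

definition Load :: com where
  "Load = Seq (Act (\<lambda>xs. map (\<lambda>i. if i = 1 then (xs ! 1, Stay)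
       else (if xs ! 0 = 2 then 4 else 3, MoveRight)) [0..<7])) (Seq
     (While (\<lambda>xs. xs ! 0 \<noteq> 0)
       (Act (\<lambda>xs. map (\<lambda>i. if i = 1 then (xs ! 1, Stay) else (xs ! 0, MoveRight)) [0..<7])))
     (While (\<lambda>xs. xs ! 0 < 3) (Move (\<lambda>_. MoveLeft) (\<lambda>_. None))))"

lemma wf_Load: "wf_com 7 5 Load"
  by (auto simp: Load_def wf_Move wf_acts_def tuples_nth_less)

definition load_state :: "bool list \<Rightarrow> nat \<Rightarrow> tape list" where
  "load_state w k = map (\<lambda>i. if i = 1 then (0, tape_contents []) else (int k,
     \<lambda>p. if p < int k then marked w p else if i = 0 then tape_contents w p else 0)) [0..<7]"

lemma run_load_step:
  assumes "a (map read_tape (load_state w k)) = marked w (int k)"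
  shows "run (Act (\<lambda>xs. map (\<lambda>i. if i = 1 then (xs ! 1, Stay) else (a xs, MoveRight)) [0..<7]))
    (load_state w k) 1 (load_state w (Suc k))"
proof -
  let ?f = "\<lambda>xs. map (\<lambda>i. if i = 1 then (xs ! 1, Stay) else (a xs, MoveRight)) [0..<7::nat]"
  let ?xs = "map read_tape (load_state w k)"
  have xs1: "?xs ! 1 = 0" by (simp add: load_state_def read_tape_def tape_contents_def)
  have "map2 act (?f ?xs) (load_state w k) = load_state w (Suc k)"
    unfolding load_state_def[of w k] map2_map_map load_state_def[of w "Suc k"]
    using xs1 assms unfolding load_state_def
    by (intro map_cong) (auto simp: act_def fun_eq_iff tape_contents_def)
  then show ?thesis
    unfolding run_def using exec_Act[of ?f "load_state w k"] by (intro exI[of _ 1]) (simp only: order_refl simp_thms)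
qed

lemma run_Load:
  assumes "w \<noteq> []"
  shows "run Load ((0, tape_contents w) # replicate 6 (0, tape_contents []))
    (4 * length w + 5) (heads w (\<lambda>_. 0) [])"
proof -
  let ?L = "length w"
  have start: "(0, tape_contents w) # replicate 6 (0, tape_contents []) = load_state w 0"
    by (rule nth_equalityI)
       (auto simp: load_state_def tape_contents_def marked_def fun_eq_iff nth_Cons' eval_nat_numeral less_Suc_eq)
  have rd: "map read_tape (load_state w k) ! 0 = tape_contents w (int k)" for k
    by (simp add: load_state_def read_tape_def)
  have 1: "run (Act (\<lambda>xs. map (\<lambda>i. if i = 1 then (xs ! 1, Stay)
       else (if xs ! 0 = 2 then 4 else 3, MoveRight)) [0..<7])) (load_state w 0) 1 (load_state w (Suc 0))"
    using assms rd[of 0] by (intro run_load_step) (cases "w ! 0"; simp add: tape_contents_def marked_def)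
  \<comment> \<open>One cell has been treated already, so \<open>?L - 1\<close> rounds
    remain.\<close>
  have 2: "run (While (\<lambda>xs. xs ! 0 \<noteq> 0)
       (Act (\<lambda>xs. map (\<lambda>i. if i = 1 then (xs ! 1, Stay) else (xs ! 0, MoveRight)) [0..<7])))
       (load_state w (Suc 0)) ((?L - 1) * Suc 1 + 1) (load_state w (Suc (?L - 1)))"
  proof (rule run_While)
    fix k assume k: "k < ?L - 1"
    show "map read_tape (load_state w (Suc k)) ! 0 \<noteq> 0"
      using k by (simp only: rd) (simp add: tape_contents_def)
    show "run (Act (\<lambda>xs. map (\<lambda>i. if i = 1 then (xs ! 1, Stay) else (xs ! 0, MoveRight)) [0..<7]))
       (load_state w (Suc k)) 1 (load_state w (Suc (Suc k)))"
      using k by (intro run_load_step, simp only: rd)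
        (cases "w ! Suc k"; simp add: tape_contents_def marked_def nat_add_distrib)
  qed (use assms in \<open>simp only: rd, simp add: tape_contents_def\<close>)
  have loaded: "load_state w (Suc (?L - 1)) = heads w (\<lambda>_. int ?L - int 0) []"
    using assms by (auto simp: load_state_def heads_def fun_eq_iff marked_def tape_contents_def)
  have 3: "run (While (\<lambda>xs. xs ! 0 < 3) (Move (\<lambda>_. MoveLeft) (\<lambda>_. None)))
       (heads w (\<lambda>_. int ?L - int 0) []) (?L * Suc 1 + 1) (heads w (\<lambda>_. int ?L - int ?L) [])"
  proof (rule run_While[where s = "\<lambda>k. heads w (\<lambda>_. int ?L - int k) []"])
    fix k
    show "run (Move (\<lambda>_. MoveLeft) (\<lambda>_. None)) (heads w (\<lambda>_. int ?L - int k) []) 1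
       (heads w (\<lambda>_. int ?L - int (Suc k)) [])"
      by (rule run_Move) auto
  qed (use assms in \<open>auto simp: read_heads reads_nth marked_less_3\<close>)
  from run_Seq[OF 1 run_Seq[OF 2[unfolded loaded] 3]]
  show ?thesis unfolding Load_def start by (auto elim!: run_mono)
qed

text \<open>Loading takes linear time and leaves all heads at \<open>0\<close>; this explains the
  precondition on \<open>c\<close>.\<close>

lemma emits_poly_time:
  assumes emits: "emits (\<lambda>w h. h = (\<lambda>_. 0)) c g" and wf: "wf_com 7 5 c"
    and enc: "\<And>x. enc_in x \<noteq> []" "\<And>x. g (enc_in x) (\<lambda>_. 0) = enc_out (f x)"
  shows "poly_time_computable enc_in enc_out f"
proof -
  obtain T where T: "poly_bounded T"
    and r: "\<And>w out. w \<noteq> [] \<Longrightarrow>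
        run c (heads w (\<lambda>_. 0) out) (T (length w)) (heads w (\<lambda>_. 0) (out @ g w (\<lambda>_. 0)))"
    using emits unfolding emits_def in_range_def by auto
  obtain M where M: "wf_tm M"
    "\<And>w t s. exec (Seq Load c) ((0, tape_contents w) # replicate (7 - 1) (0, tape_contents [])) t s \<Longrightarrow>
       \<exists>q. \<forall>t'\<ge>t. (tm_step M ^^ t') (tm_init M w) = (q, s) \<and> q = tm_halt M"
    using com_to_tm[of 7 5 "Seq Load c"] wf wf_Load by auto
  have "poly_bounded (\<lambda>n. 1 + ((4 * n + 5) + T n))" by (intro poly_bounded_intros T)
  then obtain a k where ak: "1 + ((4 * n + 5) + T n) \<le> a + a * n ^ k" for n
    unfolding poly_bounded_def by blast
  have "tm_outputs_within M (enc_in x) (a + a * length (enc_in x) ^ k) (enc_out (f x))" for x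
  proof -
    let ?w = "enc_in x"
    have "run (Seq Load c) ((0, tape_contents ?w) # replicate 6 (0, tape_contents []))
        (Suc ((4 * length ?w + 5) + T (length ?w))) (heads ?w (\<lambda>_. 0) ([] @ g ?w (\<lambda>_. 0)))"
      by (rule run_Seq[OF run_Load r]) (rule enc)+
    then obtain t where t: "exec (Seq Load c) ((0, tape_contents ?w) # replicate (7 - 1) (0, tape_contents []))
        t (heads ?w (\<lambda>_. 0) (enc_out (f x)))" "t \<le> a + a * length ?w ^ k"
      unfolding run_def using ak[of "length ?w"] by (auto simp: enc)
    from M(2)[OF t(1)] t(2) show ?thesis
      unfolding tm_outputs_within_def by (auto simp: heads_def)
  qed
  with M(1) show ?thesis unfolding poly_time_computable_def by blast
qed

section \<open>The cellular automaton\<close>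

datatype phase = TopLevel | InClause | Sign | Number | Bit | Done

instance phase :: finite
proof
  have "(UNIV :: phase set) \<subseteq> {TopLevel, InClause, Sign, Number, Bit, Done}"
    using phase.exhaust by auto
  then show "finite (UNIV :: phase set)" by (rule finite_subset) simp
qed

text \<open>
  An entry consists of a bit of the input, the parser phase and the value of the current literal.
  A tile consists of the entry of its column, the shifted entry, the shifted entry of the left
  neighbour, the flags ``the current clause is satisfied'' and ``the literals compared agree so
  far'', and the flags for the bottom and the top row.
\<close>

type_synonym entry = "bool \<times> phase \<times> bool"
type_synonym tile = "(entry \<times> entry option \<times> entry option \<times> bool \<times> bool \<times> bool \<times> bool) option"

text \<open>The parser of \<open>enc_cnf\<close>. In \<open>TopLevel\<close>,
  \<open>InClause\<close> and \<open>Number\<close> the bit read says whether another clause,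
  literal or binary digit follows; \<open>Sign\<close> reads the sign of a literal and
  \<open>Bit\<close> a digit of its variable.\<close>

fun delta :: "phase \<Rightarrow> bool \<Rightarrow> phase" where
  "delta TopLevel a = (if a then InClause else Done)"
| "delta InClause a = (if a then Sign else TopLevel)"
| "delta Sign a = Number"
| "delta Number a = (if a then Bit else InClause)"
| "delta Bit a = Number"
| "delta Done a = Done"

fun top_row :: "tile \<Rightarrow> bool" where
  "top_row None = False"
| "top_row (Some (e, sh, pr, c, k, bo, to)) = to"

fun bottom_row :: "tile \<Rightarrow> bool" where
  "bottom_row None = False"
| "bottom_row (Some (e, sh, pr, c, k, bo, to)) = bo"

text \<open>A false bit ends a clause in phase \<open>InClause\<close> and a numeral in phase
  \<open>Number\<close>. If both compared numerals end while \<open>k\<close> still holds, they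
  denote the same variable, so the two values must coincide. In the top row nothing is left of the
  shifted copy, which will force the tableau to be high enough for all shifts.\<close>

fun self :: "nat \<Rightarrow> tile \<Rightarrow> bool" where
  "self n None = False"
| "self n (Some ((a, s, v), sh, pr, c, k, bo, to)) \<longleftrightarrow>
     (n \<noteq> 0 \<longrightarrow> a = (n \<in> {2, 4}) \<and> (s = InClause \<and> \<not> a \<longrightarrow> c) \<and>
        (k \<and> s = Number \<and> \<not> a \<longrightarrow> (\<forall>v'. sh = Some (False, Number, v') \<longrightarrow> v' = v))) \<and>
     (n \<ge> 3 \<longrightarrow> s = TopLevel \<and> pr = None \<and> \<not> c \<and> \<not> k) \<and>
     (bo \<longrightarrow> sh = Some (a, s, v)) \<and> (to \<longrightarrow> sh = None)"

text \<open>A value is chosen freely at a sign bit and then kept through the numeral. The flag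
  \<open>c\<close> is cleared when a clause begins and set at a literal whose sign equals the chosen
  value. The flag \<open>k\<close> restarts where two sign bits meet and survives as long as bits
  and phases agree.\<close>

fun hor :: "tile \<Rightarrow> tile \<Rightarrow> bool" where
  "hor (Some ((a, s, v), sh, pr, c, k, bo, to)) (Some ((a', s', v'), sh', pr', c', k', bo', to')) \<longleftrightarrow>
     s' = delta s a \<and> (s' \<in> {Number, Bit} \<longrightarrow> v' = v) \<and> pr' = sh \<and> bo' = bo \<and> to' = to \<and>
     c' = (s \<noteq> TopLevel \<and> (c \<or> s = Sign \<and> v = a)) \<and>
     k' = (case sh of None \<Rightarrow> False | Some (a2, s2, v2) \<Rightarrow> s2 = s \<and> (s = Sign \<or> k \<and> a2 = a))"
| "hor t t' = False"

text \<open>The copy moves one column to the right per row. Since \<open>pr\<close> repeats the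
  shifted entry of the left neighbour, this needs no diagonal neighbour.\<close>

fun ver :: "tile \<Rightarrow> tile \<Rightarrow> bool" where
  "ver (Some (e, sh, pr, c, k, bo, to)) (Some (e', sh', pr', c', k', bo', to')) \<longleftrightarrow>
     e' = e \<and> sh' = pr \<and> \<not> bo'"
| "ver t t' = False"

lemma hor_rows: "hor t t' \<Longrightarrow> top_row t' = top_row t \<and> bottom_row t' = bottom_row t"
  by (cases "(t, t')" rule: hor.cases) auto

lemma ver_bottom: "ver t t' \<Longrightarrow> \<not> bottom_row t'"
  by (cases "(t, t')" rule: ver.cases) auto

definition tableau :: "bool list \<Rightarrow> (nat \<Rightarrow> nat \<Rightarrow> tile) \<Rightarrow> nat \<Rightarrow> bool" where
  "tableau w g H \<longleftrightarrow> (\<forall>x \<le> length w. \<forall>t \<le> H.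
     self (marked w (int x)) (g x t) \<and>
     (x < length w \<longrightarrow> hor (g x t) (g (Suc x) t)) \<and>
     (t < H \<longrightarrow> ver (g x t) (g x (Suc t))) \<and>
     top_row (g x t) = (t = H) \<and> bottom_row (g x t) = (t = 0))"

type_synonym data = "tile \<times> bool \<times> bool \<times> bool"

fun bit0 bit1 bit2 :: "data \<Rightarrow> bool" where
  "bit0 (t, x, y, z) = x"
| "bit1 (t, x, y, z) = y"
| "bit2 (t, x, y, z) = z"

text \<open>Only tiles and positions enter, and the automaton never changes these. Two
  configurations with the same image therefore agree on where the rule acts.\<close>

definition ok :: "nat \<Rightarrow> bool \<Rightarrow> bool \<Rightarrow> tile \<Rightarrow> tile \<Rightarrow> tile \<Rightarrow> bool" where
  "ok n e e' t tr tu \<longleftrightarrow> self n t \<and> (n \<noteq> 0 \<longrightarrow> e \<and> hor t tr) \<and> (\<not> top_row t \<longrightarrow> e' \<and> ver t tu)"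

text \<open>
  The arguments are the symbol at the position of the cell (\<open>0\<close> in the last column, at least \<open>3\<close> in
  the first), whether the positions of the right and the upper neighbour are as expected,
  and the data in the order of the neighbourhood below.
\<close>

definition rule :: "nat \<Rightarrow> bool \<Rightarrow> bool \<Rightarrow> data list \<Rightarrow> data" where
  "rule n e e' ds = (let d = ds ! 0; t = fst d in
     if ok n e e' t (fst (ds ! 1)) (fst (ds ! 3)) then
       (t, bit0 d \<noteq> (if n = 0 then bit1 d else bit0 (ds ! 1)),
           bit1 d \<noteq> (if n < 3 then bit1 (ds ! 2) else if top_row t then bit2 d else bit0 (ds ! 3)),
           bit2 d \<noteq> (n \<ge> 3 \<and> (if bottom_row t then bit0 d else bit2 (ds ! 4))))
     else d)"

definition nbhd :: "(int \<times> int) list" where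
  "nbhd = [(0, 0), (1, 0), (-1, 0), (0, 1), (0, -1)]"

definition local_rule :: "bool list \<Rightarrow> (data \<times> nat) list \<Rightarrow> data \<times> nat" where
  "local_rule w xs = (let ps = map snd xs in
     (rule (marked w (int (ps ! 0))) (ps ! 1 = Suc (ps ! 0)) (ps ! 3 = ps ! 0) (map fst xs), ps ! 0))"

definition global :: "bool list \<Rightarrow> (int \<times> int \<Rightarrow> data \<times> nat) \<Rightarrow> (int \<times> int \<Rightarrow> data \<times> nat)" where
  "global w X y = local_rule w (map (\<lambda>x. X (y + x)) nbhd)"

text \<open>A cell without a tile never fits, so its data are kept. The position
  \<open>length w\<close> leaves an empty suffix, so the code of this state does not depend on
  \<open>w\<close>.\<close>

definition quiet :: "bool list \<Rightarrow> data \<times> nat" where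
  "quiet w = ((None, False, False, False), length w)"

section \<open>Collisions of configurations and tableaux\<close>

lemma fst_rule: "fst (rule n e e' ds) = fst (ds ! 0)"
  by (simp add: rule_def Let_def)

lemma rule_None: "fst (ds ! 0) = None \<Longrightarrow> rule n e e' ds = ds ! 0"
  by (simp add: rule_def ok_def)

lemma add_origin [simp]: "(y :: int \<times> int) + (0, 0) = y"
  by (cases y) auto

lemma bit_simps: "bit0 d = fst (snd d)" "bit1 d = fst (snd (snd d))" "bit2 d = snd (snd (snd d))"
  by (cases d; simp)+

text \<open>Give all bits on the walk the same value \<open>b\<close>. Every bit is then added to an
  equal one, so the image has only false bits, whether \<open>b\<close> is true or not. Outside the
  first column bit 2 lies off the walk and is kept, whence it is set to false there.\<close>

lemma tableau_imp_collision:
  assumes w: "w \<noteq> []" and g: "tableau w g H"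
  obtains X X' where "X \<noteq> X'" "global w X = global w X'"
    "\<And>y. snd (X y) \<le> length w" "\<And>y. snd (X' y) \<le> length w"
    "\<And>y. y \<notin> {0..int (length w)} \<times> {0..int H} \<Longrightarrow> X y = quiet w \<and> X' y = quiet w"
proof -
  let ?L = "length w"
  define R where "R = {0..int ?L} \<times> {0..int H}"
  define Z where "Z b y = (if y \<in> R then ((g (nat (fst y)) (nat (snd y)), b, b, b \<and> fst y = 0), nat (fst y))
    else quiet w)" for b :: bool and y :: "int \<times> int"
  have "global w (Z False) y = global w (Z True) y" for y
  proof (cases "y \<in> R")
    case False
    then have "Z b y = quiet w" for b by (simp add: Z_def)
    then show ?thesis
      by (simp add: global_def local_rule_def nbhd_def quiet_def rule_None Let_def)
  next
    case True
    then obtain x t where xt: "y = (int x, int t)" "x \<le> ?L" "t \<le> H"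
      by (auto simp: R_def) (metis nat_0_le nat_le_iff)
    have Z: "Z b (int i, int j) = ((g i j, b, b, b \<and> i = 0), i)" if "i \<le> ?L" "j \<le> H" for i j b
      using that by (simp add: Z_def R_def)
    have n: "marked w (int x) = 0 \<longleftrightarrow> x = ?L" "marked w (int x) < 3 \<longleftrightarrow> x \<noteq> 0"
      using xt w by (auto simp: marked_eq_0 marked_less_3)
    have n3: "3 \<le> marked w (int x) \<longleftrightarrow> x = 0" using n(2) by linarith
    have rows: "top_row (g x t) = (t = H)" "bottom_row (g x t) = (t = 0)"
      using g xt by (auto simp: tableau_def)
    have "global w (Z b) (int x, int t) = ((g x t, False, False, False), x)" for b
    proof -
      let ?r = "Z b (int x + 1, int t)" and ?l = "Z b (int x - 1, int t)"
        and ?u = "Z b (int x, int t + 1)" and ?d = "Z b (int x, int t - 1)"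
      have r: "?r = ((g (Suc x) t, b, b, False), Suc x)" if "x \<noteq> ?L"
        using Z[of "Suc x" t b] that xt by (simp add: add.commute)
      have l: "bit1 (fst ?l) = b" if "x \<noteq> 0"
        using Z[of "x - 1" t b] that xt by (simp add: of_nat_diff)
      have u: "?u = ((g x (Suc t), b, b, b \<and> x = 0), x)" if "t \<noteq> H"
        using Z[of x "Suc t" b] that xt by (simp add: add.commute)
      have d: "bit2 (fst ?d) = (b \<and> x = 0)" if "t \<noteq> 0"
        using Z[of x "t - 1" b] that xt by (simp add: of_nat_diff)
      have "ok (marked w (int x)) (snd ?r = Suc x) (snd ?u = x) (g x t) (fst (fst ?r)) (fst (fst ?u))"
        using g xt r u unfolding ok_def n rows tableau_def by auto
      then show ?thesis
        using r l u d n(1) n(2) n3 rows Z[OF xt(2,3), of b]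
        by (auto simp: global_def local_rule_def nbhd_def rule_def Let_def)
    qed
    then show ?thesis by (simp add: xt)
  qed
  then have "global w (Z False) = global w (Z True)" by auto
  moreover have "Z False (0, 0) \<noteq> Z True (0, 0)" by (simp add: Z_def R_def)
  then have "Z False \<noteq> Z True" by metis
  ultimately show ?thesis
    by (intro that[of "Z False" "Z True"]) (auto simp: Z_def R_def quiet_def)
qed

text \<open>A straight walk that never met \<open>P\<close> would embed the natural numbers into the
  finite set \<open>D\<close>. Taking the least hit makes all earlier points avoid
  \<open>P\<close>.\<close>

lemma finite_walk:
  fixes a b :: int
  assumes "finite D" "(y, z) \<in> D" "a \<noteq> 0 \<or> b \<noteq> 0"
    and step: "\<And>y z. (y, z) \<in> D \<Longrightarrow> P (y, z) \<or> (y + a, z + b) \<in> D"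
  obtains n where "P (y + int n * a, z + int n * b)"
    "\<And>m. m \<le> n \<Longrightarrow> (y + int m * a, z + int m * b) \<in> D"
    "\<And>m. m < n \<Longrightarrow> \<not> P (y + int m * a, z + int m * b)"
proof -
  let ?f = "\<lambda>n. (y + int n * a, z + int n * b)"
  have in_D: "?f m \<in> D" if "\<And>k. k < m \<Longrightarrow> \<not> P (?f k)" for m
    using that
  proof (induction m)
    case (Suc m)
    then have "?f m \<in> D" "\<not> P (?f m)" by auto
    from step[OF this(1)] this(2) show ?case by (simp add: algebra_simps)
  qed (use assms in simp)
  have "\<exists>n. P (?f n)"
  proof (rule ccontr)
    assume "\<not> ?thesis"
    then have "range ?f \<subseteq> D" using in_D by blast
    then have "finite (range ?f)" using assms(1) finite_subset by blast
    moreover have "inj ?f" using assms(3) by (auto simp: inj_def)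
    ultimately show False using finite_imageD infinite_UNIV_nat by blast
  qed
  then have "P (?f (LEAST n. P (?f n)))" by (rule LeastI_ex)
  moreover have "\<not> P (?f m)" if "m < (LEAST n. P (?f n))" for m
    using that not_less_Least by blast
  ultimately show ?thesis using in_D by (intro that) auto
qed

text \<open>The cells where bits 0, 1 and 2 differ form finite sets that are closed under passing to
  the successor on the walk. Every straight stretch must therefore end, which is possible only at a
  turning point in a cell that fits.\<close>

lemma collision_imp_tableau:
  assumes w: "w \<noteq> []" and X: "X \<noteq> X'" "global w X = global w X'"
    and p: "\<And>y. snd (X y) \<le> length w"
    and fin: "finite {y. X y \<noteq> q}" "finite {y. X' y \<noteq> q}"
  obtains g H where "tableau w g H"
proof -
  let ?L = "length w"
  define T where "T y = fst (fst (X y))" for y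
  define c where "c y = snd (X y)" for y
  define N where "N y = marked w (int (c y))" for y
  define OK where "OK y = ok (N y) (c (y + (1, 0)) = Suc (c y)) (c (y + (0, 1)) = c y)
    (T y) (T (y + (1, 0))) (T (y + (0, 1)))" for y
  have eq: "global w X y = global w X' y" for y using X(2) by simp
  have c': "snd (X' y) = c y" for y
    using arg_cong[OF eq[of y], of snd] by (simp add: global_def local_rule_def nbhd_def c_def Let_def)
  have T': "fst (fst (X' y)) = T y" for y
    using arg_cong[OF eq[of y], of "\<lambda>z. fst (fst z)"]
    by (simp add: global_def local_rule_def nbhd_def T_def Let_def fst_rule)
  define D0 where "D0 = {y. bit0 (fst (X y)) \<noteq> bit0 (fst (X' y))}"
  define D1 where "D1 = {y. bit1 (fst (X y)) \<noteq> bit1 (fst (X' y))}"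
  define D2 where "D2 = {y. bit2 (fst (X y)) \<noteq> bit2 (fst (X' y))}"
  have N0: "N y = 0 \<longleftrightarrow> c y = ?L" for y
    using p[of y] by (auto simp: N_def c_def marked_eq_0)
  have N3: "N y < 3 \<longleftrightarrow> c y \<noteq> 0" for y
    using w by (auto simp: N_def marked_less_3)
  have N3': "3 \<le> N y \<longleftrightarrow> c y = 0" for y using N3[of y] by linarith
  have expand: "rule (N y) (c (y + (1, 0)) = Suc (c y)) (c (y + (0, 1)) = c y)
      [fst (X y), fst (X (y + (1, 0))), fst (X (y + (-1, 0))), fst (X (y + (0, 1))), fst (X (y + (0, -1)))]
    = rule (N y) (c (y + (1, 0)) = Suc (c y)) (c (y + (0, 1)) = c y)
      [fst (X' y), fst (X' (y + (1, 0))), fst (X' (y + (-1, 0))), fst (X' (y + (0, 1))), fst (X' (y + (0, -1)))]" for y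
    using eq[of y]
    by (simp add: global_def local_rule_def nbhd_def Let_def N_def c_def[symmetric] c')
  \<comment> \<open>The data part of the image, with the tests on the symbol expressed by the
    position. Its test \<open>OK\<close> and its tiles are common to both configurations.\<close>
  define F where "F Z y = (if OK y then
       (T y, bit0 (fst (Z y)) \<noteq> (if c y = ?L then bit1 (fst (Z y)) else bit0 (fst (Z (y + (1, 0))))),
           bit1 (fst (Z y)) \<noteq> (if c y \<noteq> 0 then bit1 (fst (Z (y + (-1, 0))))
             else if top_row (T y) then bit2 (fst (Z y)) else bit0 (fst (Z (y + (0, 1))))),
           bit2 (fst (Z y)) \<noteq> (c y = 0 \<and>
             (if bottom_row (T y) then bit0 (fst (Z y)) else bit2 (fst (Z (y + (0, -1)))))))
       else fst (Z y))" for Z :: "int \<times> int \<Rightarrow> data \<times> nat" and y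
  have "rule (N y) (c (y + (1, 0)) = Suc (c y)) (c (y + (0, 1)) = c y)
      [fst (Z y), fst (Z (y + (1, 0))), fst (Z (y + (-1, 0))), fst (Z (y + (0, 1))), fst (Z (y + (0, -1)))]
      = F Z y" if "\<And>y. fst (fst (Z y)) = T y" for Z y
    unfolding rule_def Let_def F_def by (simp add: that OK_def[symmetric] N0 N3 N3')
  from expand[unfolded this[OF T_def[symmetric]] this[OF T']] have split: "F X y = F X' y" for y .
  \<comment> \<open>If a bit differs but its image does not, then the cell fits and the bit added to
    it differs as well. The same argument gives the next two facts.\<close>
  have D0: "OK y \<and> (if c y = ?L then y \<in> D1 else y + (1, 0) \<in> D0)" if "y \<in> D0" for y
    using split[of y] that by (auto simp: F_def D0_def D1_def split: if_splits)
  have D1: "OK y \<and> (if c y \<noteq> 0 then y + (-1, 0) \<in> D1 else if top_row (T y) then y \<in> D2 else y + (0, 1) \<in> D0)"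
    if "y \<in> D1" for y
    using split[of y] that by (auto simp: F_def D0_def D1_def D2_def split: if_splits)
  have D2: "OK y \<and> c y = 0 \<and> (if bottom_row (T y) then y \<in> D0 else y + (0, -1) \<in> D2)"
    if "y \<in> D2" for y
    using split[of y] that by (auto simp: F_def D0_def D1_def D2_def split: if_splits)
  have sub: "D0 \<union> D1 \<union> D2 \<subseteq> {y. X y \<noteq> q} \<union> {y. X' y \<noteq> q}"
    by (auto simp: D0_def D1_def D2_def)
  then have finD: "finite D0" "finite D1" "finite D2"
    using fin by (meson finite_UnI finite_subset le_sup_iff)+
  obtain y where "X y \<noteq> X' y" using X(1) by blast
  then have "fst (X y) \<noteq> fst (X' y)" using c'[of y] by (auto simp: c_def prod_eq_iff)
  moreover have "fst (fst (X y)) = fst (fst (X' y))" using T'[of y] by (simp add: T_def)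
  ultimately have "y \<in> D0 \<union> D1 \<union> D2"
    by (auto simp: D0_def D1_def D2_def bit_simps prod_eq_iff)
  moreover have D2_D0: "\<exists>y. y \<in> D0 \<and> c y = 0 \<and> bottom_row (T y)" if "y \<in> D2" for y
  proof -
    obtain y1 y2 where y: "y = (y1, y2)" by fastforce
    have "bottom_row (T (u, v)) \<or> (u + 0, v + (-1)) \<in> D2" if "(u, v) \<in> D2" for u v
      using D2[OF that] by (auto split: if_splits)
    from finite_walk[of D2 y1 y2 0 "-1" "\<lambda>y. bottom_row (T y)", OF finD(3) _ _ this] \<open>y \<in> D2\<close> y
    obtain n where "bottom_row (T (y1 + int n * 0, y2 + int n * (-1)))"
      "(y1 + int n * 0, y2 + int n * (-1)) \<in> D2" by (metis order_refl zero_neq_neg_one)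
    then show ?thesis using D2 by fastforce
  qed
  moreover have D0_D1: "\<exists>y. y \<in> D1" if "y \<in> D0" for y
  proof -
    obtain y1 y2 where y: "y = (y1, y2)" by fastforce
    have "c (u, v) = ?L \<or> (u + 1, v + 0) \<in> D0" if "(u, v) \<in> D0" for u v
      using D0[OF that] by (auto split: if_splits)
    from finite_walk[of D0 y1 y2 1 0 "\<lambda>y. c y = ?L", OF finD(1) _ _ this] \<open>y \<in> D0\<close> y
    obtain n where "c (y1 + int n * 1, y2 + int n * 0) = ?L"
      "(y1 + int n * 1, y2 + int n * 0) \<in> D0" by (metis order_refl zero_neq_one)
    then show ?thesis using D0 by fastforce
  qed
  \<comment> \<open>Differences in bit 2 lead down to one in bit 0, and differences in bit 0 lead
    right to one in bit 1.\<close>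
  ultimately obtain y where y: "y \<in> D1" by blast
  obtain z where z: "z \<in> D1" "c z = 0"
  proof -
    obtain y1 y2 where y': "y = (y1, y2)" by fastforce
    have "c (u, v) = 0 \<or> (u + (-1), v + 0) \<in> D1" if "(u, v) \<in> D1" for u v
      using D1[OF that] by (auto split: if_splits)
    from finite_walk[of D1 y1 y2 "-1" 0 "\<lambda>y. c y = 0", OF finD(2) _ _ this] y y'
    obtain n where "c (y1 + int n * (-1), y2 + int n * 0) = 0"
      "(y1 + int n * (-1), y2 + int n * 0) \<in> D1" by (metis order_refl zero_neq_neg_one)
    then show ?thesis using that by blast
  qed
  \<comment> \<open>Each fitting cell before the last column requires the next position at its
    right, so the walk visits the positions \<open>0\<close> to \<open>?L\<close> in order before it
    can turn.\<close>
  have row: "(u + int x, v) \<in> D0 \<and> c (u + int x, v) = x" if "(u, v) \<in> D0" "c (u, v) = 0" "x \<le> ?L" for u v x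
    using that(3)
  proof (induction x)
    case (Suc x)
    then have "(u + int x, v) \<in> D0" "c (u + int x, v) = x" "x < ?L" by auto
    from D0[OF this(1)] this(2,3) show ?case
      using N0[of "(u + int x, v)"] by (auto simp: OK_def ok_def ac_simps)
  qed (use that in auto)
  have row_back: "(u, v) \<in> D1" if "(u, v) \<in> D0" "c (u, v) = 0" for u v
  proof -
    have "(u + int (?L - x), v) \<in> D1" if "x \<le> ?L" for x
      using that
    proof (induction x)
      case 0
      from row[OF \<open>(u, v) \<in> D0\<close> \<open>c (u, v) = 0\<close>, of ?L] show ?case using D0 by fastforce
    next
      case (Suc x)
      then have "(u + int (?L - x), v) \<in> D1" "c (u + int (?L - x), v) = ?L - x" "x < ?L"
        using row[OF \<open>(u, v) \<in> D0\<close> \<open>c (u, v) = 0\<close>, of "?L - x"] by auto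
      from D1[OF this(1)] this(2,3) show ?case by (auto simp: of_nat_diff algebra_simps split: if_splits)
    qed
    from this[of ?L] show ?thesis by simp
  qed
  \<comment> \<open>The cells of the left border where a row of the walk starts.\<close>
  define E where "E = {y \<in> D0. c y = 0}"
  have finE: "finite E" using finD by (simp add: E_def)
  have up: "top_row (T (u, v)) \<or> (u + 0, v + 1) \<in> E" if "(u, v) \<in> E" for u v
  proof -
    from that have "(u, v) \<in> D1" "c (u, v) = 0" using row_back by (auto simp: E_def)
    with D1[of "(u, v)"] show ?thesis by (auto simp: E_def OK_def ok_def)
  qed
  have E_top: "\<exists>y. y \<in> D2" if "(u, v) \<in> E" for u v
  proof -
    from finite_walk[of E u v 0 1 "\<lambda>y. top_row (T y)", OF finE that _ up]
    obtain n where "top_row (T (u + int n * 0, v + int n * 1))" "(u + int n * 0, v + int n * 1) \<in> E"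
      by (metis order_refl zero_neq_one)
    then have "(u, v + int n) \<in> D1" "c (u, v + int n) = 0" "top_row (T (u, v + int n))"
      using row_back by (auto simp: E_def)
    with D1[OF this(1)] show ?thesis by auto
  qed
  \<comment> \<open>From \<open>z\<close> the walk climbs to a top cell. The rows below
    \<open>z\<close> have not been seen yet, so it is then followed down to a bottom cell.\<close>
  have "\<exists>y. y \<in> D2"
  proof (cases "top_row (T z)")
    case True
    with z D1[OF z(1)] have "z \<in> D2" by simp
    then show ?thesis ..
  next
    case False
    then have "z + (0, 1) \<in> E" using D1[OF z(1)] z(2) by (auto simp: E_def OK_def ok_def)
    then show ?thesis using E_top by (metis surj_pair)
  qed
  then obtain u v where uv: "(u, v) \<in> D0" "c (u, v) = 0" "bottom_row (T (u, v))"
    using D2_D0 by (metis surj_pair)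
  then have "(u, v) \<in> E" by (simp add: E_def)
  \<comment> \<open>This second climb starts in a bottom cell and stops at the first top cell, so
    its rows form a complete rectangle of height index \<open>H\<close>.\<close>
  obtain H where H: "top_row (T (u + int H * 0, v + int H * 1))"
      "\<And>m. m \<le> H \<Longrightarrow> (u + int m * 0, v + int m * 1) \<in> E"
      "\<And>m. m < H \<Longrightarrow> \<not> top_row (T (u + int m * 0, v + int m * 1))"
    by (rule finite_walk[of E u v 0 1 "\<lambda>y. top_row (T y)", OF finE \<open>(u, v) \<in> E\<close> _ up]) auto
  define g where "g x t = T (u + int x, v + int t)" for x t
  have cell: "(u + int x, v + int t) \<in> D0" "c (u + int x, v + int t) = x" if "x \<le> ?L" "t \<le> H" for x t
    using row[of u "v + int t" x] H(2)[of t] that by (auto simp: E_def)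
  have ok: "self (marked w (int x)) (g x t)" "x < ?L \<Longrightarrow> hor (g x t) (g (Suc x) t)"
      "\<not> top_row (g x t) \<Longrightarrow> ver (g x t) (g x (Suc t))"
    if "x \<le> ?L" "t \<le> H" for x t
    using D0[OF cell(1)[OF that]] cell(2)[OF that] that N0[of "(u + int x, v + int t)"]
    by (auto simp: OK_def ok_def g_def N_def ac_simps)
  have rows: "top_row (g x t) = top_row (g 0 t) \<and> bottom_row (g x t) = bottom_row (g 0 t)"
    if "x \<le> ?L" "t \<le> H" for x t
    using that
  proof (induction x)
    case (Suc x)
    then show ?case using hor_rows[OF ok(2)[of x t]] by auto
  qed simp
  have top: "top_row (g 0 t) = (t = H)" if "t \<le> H" for t
    using H(1) H(3)[of t] that by (cases "t = H") (auto simp: g_def)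
  have bottom: "bottom_row (g 0 t) = (t = 0)" if "t \<le> H" for t
  proof (cases t)
    case (Suc t')
    with that have "ver (g 0 t') (g 0 t)" using ok(3)[of 0 t'] top[of t'] by auto
    with Suc show ?thesis using ver_bottom by auto
  qed (use uv in \<open>simp add: g_def\<close>)
  have "tableau w g H"
    unfolding tableau_def using ok rows top bottom by (metis nat_less_le)
  then show ?thesis by (rule that)
qed

section \<open>Tableaux and satisfiability\<close>

definition phase_at :: "bool list \<Rightarrow> nat \<Rightarrow> phase" where
  "phase_at w x = foldl delta TopLevel (take x w)"

fun sat_at :: "bool list \<Rightarrow> (nat \<Rightarrow> bool) \<Rightarrow> nat \<Rightarrow> bool" where
  "sat_at w v 0 = False"
| "sat_at w v (Suc x) \<longleftrightarrow>
     phase_at w x \<noteq> TopLevel \<and> (sat_at w v x \<or> phase_at w x = Sign \<and> v x = w ! x)"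

text \<open>Does the literal read at position \<open>x\<close> agree so far with the one read at position \<open>x - t\<close>?\<close>

fun match_at :: "bool list \<Rightarrow> nat \<Rightarrow> nat \<Rightarrow> bool" where
  "match_at w t 0 = False"
| "match_at w t (Suc x) \<longleftrightarrow> t \<le> x \<and> phase_at w (x - t) = phase_at w x \<and>
     (phase_at w x = Sign \<or> match_at w t x \<and> w ! (x - t) = w ! x)"

text \<open>What remains of a tableau when every component except the truth values is written as a
  function of the word: values are constant along a literal, clauses are satisfied where they end,
  and numerals that match up to their common end carry equal values.\<close>

definition admissible :: "bool list \<Rightarrow> (nat \<Rightarrow> bool) \<Rightarrow> bool" where
  "admissible w v \<longleftrightarrow>
     (\<forall>x < length w. phase_at w (Suc x) \<in> {Number, Bit} \<longrightarrow> v (Suc x) = v x) \<and>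
     (\<forall>x < length w. phase_at w x = InClause \<and> \<not> w ! x \<longrightarrow> sat_at w v x) \<and>
     (\<forall>t. \<forall>x < length w. t \<le> x \<and> match_at w t x \<and> phase_at w x = Number \<and> \<not> w ! x \<and>
        phase_at w (x - t) = Number \<and> \<not> w ! (x - t) \<longrightarrow> v (x - t) = v x)"

lemma phase_at_0 [simp]: "phase_at w 0 = TopLevel"
  by (simp add: phase_at_def)

lemma phase_at_Suc: "x < length w \<Longrightarrow> phase_at w (Suc x) = delta (phase_at w x) (w ! x)"
  by (simp add: phase_at_def take_Suc_conv_app_nth)

lemma marked_bit: "x < length w \<Longrightarrow> marked w (int x) \<in> {2, 4} \<longleftrightarrow> w ! x"
  by (cases "w ! x") (auto simp: marked_def)

text \<open>All components are determined by the values in the bottom row: induction along a row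
  gives phases and flags, and induction over the rows identifies the shifted entry in row
  \<open>t\<close> with the entry \<open>t\<close> columns to the left.\<close>

lemma tableau_imp_admissible:
  assumes w: "w \<noteq> []" and g: "tableau w g H"
  obtains v where "admissible w v"
proof -
  let ?L = "length w"
  have G: "self (marked w (int x)) (g x t)" "x < ?L \<Longrightarrow> hor (g x t) (g (Suc x) t)"
      "t < H \<Longrightarrow> ver (g x t) (g x (Suc t))" "top_row (g x t) = (t = H)" "bottom_row (g x t) = (t = 0)"
    if "x \<le> ?L" "t \<le> H" for x t
    using g that unfolding tableau_def by blast+
  define get where "get x t = the (g x t)" for x t
  define e where "e x t = fst (get x t)" for x t
  define sh where "sh x t = fst (snd (get x t))" for x t
  define pr where "pr x t = fst (snd (snd (get x t)))" for x t
  define c where "c x t = fst (snd (snd (snd (get x t))))" for x t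
  define k where "k x t = fst (snd (snd (snd (snd (get x t)))))" for x t
  define bo where "bo x t = fst (snd (snd (snd (snd (snd (get x t))))))" for x t
  define to where "to x t = snd (snd (snd (snd (snd (snd (get x t))))))" for x t
  define a where "a x t = fst (e x t)" for x t
  define s where "s x t = fst (snd (e x t))" for x t
  define v where "v x t = snd (snd (e x t))" for x t
  have g_eq: "g x t = Some ((a x t, s x t, v x t), sh x t, pr x t, c x t, k x t, bo x t, to x t)"
    if "x \<le> ?L" "t \<le> H" for x t
    using G(1)[OF that] by (cases "g x t")
      (auto simp: get_def e_def sh_def pr_def c_def k_def bo_def to_def a_def s_def v_def)
  have bo: "bo x t = (t = 0)" and to: "to x t = (t = H)" if "x \<le> ?L" "t \<le> H" for x t
    using G(4,5)[OF that] g_eq[OF that] by auto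
  have a: "a x t = w ! x" if "x < ?L" "t \<le> H" for x t
    using G(1)[of x t] g_eq[of x t] that marked_bit[of x w] by (auto simp: marked_eq_0)
  have marked0: "3 \<le> marked w 0"
    using marked_less_3[OF w, of 0] by simp
  have init: "s 0 t = TopLevel" "pr 0 t = None" "\<not> c 0 t" "\<not> k 0 t" if "t \<le> H" for t
    using G(1)[of 0 t] g_eq[of 0 t] that marked0 by auto
  have step: "s (Suc x) t = delta (s x t) (w ! x)"
      "s (Suc x) t \<in> {Number, Bit} \<Longrightarrow> v (Suc x) t = v x t" "pr (Suc x) t = sh x t"
      "c (Suc x) t = (s x t \<noteq> TopLevel \<and> (c x t \<or> s x t = Sign \<and> v x t = w ! x))"
      "k (Suc x) t = (case sh x t of None \<Rightarrow> False | Some (a2, s2, v2) \<Rightarrow>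
         s2 = s x t \<and> (s x t = Sign \<or> k x t \<and> a2 = w ! x))"
    if "x < ?L" "t \<le> H" for x t
    using G(2)[of x t] g_eq[of x t] g_eq[of "Suc x" t] that a[of x t] by auto
  have vert: "a x (Suc t) = a x t" "s x (Suc t) = s x t" "v x (Suc t) = v x t" "sh x (Suc t) = pr x t"
    if "x \<le> ?L" "t < H" for x t
    using G(3)[of x t] g_eq[of x t] g_eq[of x "Suc t"] that by auto
  have s: "s x t = phase_at w x" if "x \<le> ?L" "t \<le> H" for x t
    using that by (induction x) (auto simp: init step phase_at_Suc)
  have v: "v x t = v x 0" if "x \<le> ?L" "t \<le> H" for x t
    using that by (induction t) (auto simp: vert)
  have c: "c x t = sat_at w (\<lambda>x. v x 0) x" if "x \<le> ?L" "t \<le> H" for x t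
    using that
  proof (induction x)
    case (Suc x)
    then show ?case using v[of x t] by (auto simp: step s)
  qed (simp add: init)
  \<comment> \<open>The bit is left as \<open>a (x - t) 0\<close>, since in the last column, behind
    the word, it is unconstrained.\<close>
  have sh: "sh x t = (if t \<le> x then Some (a (x - t) 0, phase_at w (x - t), v (x - t) 0) else None)"
    if "x \<le> ?L" "t \<le> H" for x t
    using that
  proof (induction t arbitrary: x)
    case 0
    then show ?case using G(1)[of x 0] g_eq[of x 0] bo[of x 0] s[of x 0] by auto
  next
    case (Suc t)
    show ?case
    proof (cases x)
      case 0
      then show ?thesis using Suc.prems vert(4)[of x t] init(2)[of t] by auto
    next
      case (Suc y)
      then show ?thesis using Suc.prems Suc.IH[of y] vert(4)[of x t] step(3)[of y t] by auto
    qed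
  qed
  have k: "k x t = match_at w t x" if "x \<le> ?L" "t \<le> H" for x t
    using that
  proof (induction x)
    case (Suc x)
    then show ?case using a[of "x - t" 0] by (auto simp: step sh s)
  qed (simp add: init)
  \<comment> \<open>With \<open>H \<le> ?L\<close> the last column of the top row would still
    contain a shifted entry. Hence a row exists for every shift up to \<open>?L\<close>.\<close>
  have "?L < H"
  proof (rule ccontr)
    assume "\<not> ?L < H"
    then have "sh ?L H \<noteq> None" using sh[of ?L H] by simp
    then show False using G(1)[of ?L H] g_eq[of ?L H] to[of ?L H] by auto
  qed
  have "admissible w (\<lambda>x. v x 0)"
    unfolding admissible_def
  proof (intro conjI allI impI)
    fix x assume "x < ?L" "phase_at w (Suc x) \<in> {Number, Bit}"
    then show "v (Suc x) 0 = v x 0" using step(2)[of x 0] s[of "Suc x" 0] by auto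
  next
    fix x assume x: "x < ?L" "phase_at w x = InClause \<and> \<not> w ! x"
    then have "marked w (int x) \<noteq> 0" by (simp add: marked_eq_0)
    then show "sat_at w (\<lambda>x. v x 0) x"
      using x G(1)[of x 0] g_eq[of x 0] a[of x 0] s[of x 0] c[of x 0] by auto
  next
    fix t x assume x: "x < ?L" and
      *: "t \<le> x \<and> match_at w t x \<and> phase_at w x = Number \<and> \<not> w ! x \<and>
        phase_at w (x - t) = Number \<and> \<not> w ! (x - t)"
    have "marked w (int x) \<noteq> 0" using x by (simp add: marked_eq_0)
    then show "v (x - t) 0 = v x 0"
      using x * \<open>?L < H\<close> G(1)[of x t] g_eq[of x t] a[of x t] a[of "x - t" 0] s[of x t] k[of x t] sh[of x t] v[of x t]
      by auto
  qed
  then show ?thesis by (rule that)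
qed

text \<open>The height index \<open>Suc (length w)\<close> is the first shift that moves all
  columns, including the one behind the word, out of the rectangle.\<close>

lemma admissible_imp_tableau:
  assumes w: "w \<noteq> []" and v: "admissible w v"
  obtains g where "tableau w g (Suc (length w))"
proof -
  let ?L = "length w"
  define e where "e x = (x < ?L \<and> w ! x, phase_at w x, v x)" for x
  define g where "g x t = Some (e x, if t \<le> x then Some (e (x - t)) else None,
     if Suc t \<le> x then Some (e (x - Suc t)) else None,
     sat_at w v x, match_at w t x, t = 0, t = Suc ?L)" for x t
  have "tableau w g (Suc ?L)"
    unfolding tableau_def
  proof (intro allI impI conjI)
    fix x t assume x: "x \<le> ?L" "t \<le> Suc ?L"
    have A: "marked w (int x) \<noteq> 0 \<Longrightarrow> x < ?L" using x by (simp add: marked_eq_0)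
    have B: "3 \<le> marked w (int x) \<longleftrightarrow> x = 0" using marked_less_3[OF w, of "int x"] by auto
    show "self (marked w (int x)) (g x t)"
      using A B x v marked_bit[of x w] unfolding admissible_def g_def e_def self.simps B
      by (auto split: if_splits)
    show "hor (g x t) (g (Suc x) t)" if "x < ?L"
      using that v phase_at_Suc[of x w]
      by (auto simp: admissible_def g_def e_def)
    show "ver (g x t) (g x (Suc t))" if "t < Suc ?L" by (simp add: g_def)
    show "top_row (g x t) = (t = Suc ?L)" "bottom_row (g x t) = (t = 0)" by (simp_all add: g_def)
  qed
  then show ?thesis by (rule that)
qed

section \<open>Parsing the encoding of a formula\<close>

lemma enc_bits_Nil: "enc_bits [] = [False]"
  and enc_bits_Cons: "enc_bits (b # bs) = True # b # enc_bits bs"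
  by (simp_all add: enc_bits_def enc_list_def)

lemma drop_nth: "drop p w = a # r \<Longrightarrow> p < length w \<and> w ! p = a \<and> drop (Suc p) w = r"
  by (metis Cons_nth_drop_Suc drop_eq_Nil list.discI list.inject not_le_imp_less)

text \<open>Digits and continuation flags alternate, so a false bit in phase \<open>Number\<close>
  occurs exactly at the end of the numeral. No sign bit is passed, which keeps \<open>sat_at\<close>
  constant.\<close>

lemma scan_bits:
  assumes "drop p w = enc_bits bs @ rest" "phase_at w p = Number"
  obtains q where "q = p + length (enc_bits bs)" "p < q" "q \<le> length w" "drop q w = rest"
    "phase_at w q = InClause"
    "\<And>r. p \<le> r \<Longrightarrow> r < q \<Longrightarrow> phase_at w r \<in> {Number, Bit} \<and> (phase_at w r = Number \<and> \<not> w ! r \<longleftrightarrow> Suc r = q)"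
    "\<And>v. sat_at w v q = sat_at w v p"
proof -
  have "\<exists>q. q = p + length (enc_bits bs) \<and> p < q \<and> q \<le> length w \<and> drop q w = rest \<and>
    phase_at w q = InClause \<and>
    (\<forall>r. p \<le> r \<longrightarrow> r < q \<longrightarrow> phase_at w r \<in> {Number, Bit} \<and> (phase_at w r = Number \<and> \<not> w ! r \<longleftrightarrow> Suc r = q)) \<and>
    (\<forall>v. sat_at w v q = sat_at w v p)"
    using assms
  proof (induction bs arbitrary: p)
    case Nil
    then have p: "p < length w" "\<not> w ! p" "drop (Suc p) w = rest"
      using drop_nth[of p w False rest] by (auto simp: enc_bits_Nil)
    then show ?case using Nil(2) by (intro exI[of _ "Suc p"]) (auto simp: enc_bits_Nil phase_at_Suc less_Suc_eq)
  next
    case (Cons b bs)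
    have p: "p < length w" "w ! p" "drop (Suc p) w = b # enc_bits bs @ rest"
      using drop_nth[of p w True "b # enc_bits bs @ rest"] Cons.prems by (auto simp: enc_bits_Cons)
    have p': "Suc p < length w" "w ! Suc p = b" "drop (Suc (Suc p)) w = enc_bits bs @ rest"
      using drop_nth[OF p(3)] by auto
    have ph: "phase_at w (Suc p) = Bit" "phase_at w (Suc (Suc p)) = Number"
      using p p' Cons.prems(2) by (auto simp: phase_at_Suc)
    from Cons.IH[OF p'(3) ph(2)] obtain q where
      q: "q = Suc (Suc p) + length (enc_bits bs)" "Suc (Suc p) < q" "q \<le> length w" "drop q w = rest"
      "phase_at w q = InClause"
      "\<forall>r. Suc (Suc p) \<le> r \<longrightarrow> r < q \<longrightarrow>
         phase_at w r \<in> {Number, Bit} \<and> (phase_at w r = Number \<and> \<not> w ! r \<longleftrightarrow> Suc r = q)"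
      "\<forall>v. sat_at w v q = sat_at w v (Suc (Suc p))" by blast
    have "phase_at w r \<in> {Number, Bit} \<and> (phase_at w r = Number \<and> \<not> w ! r \<longleftrightarrow> Suc r = q)"
      if "p \<le> r" "r < q" for r
    proof -
      from that(1) consider "r = p" | "r = Suc p" | "Suc (Suc p) \<le> r" by linarith
      then show ?thesis using p ph q that Cons.prems(2) by cases auto
    qed
    moreover have "sat_at w v q = sat_at w v p" for v
      using q(7) ph Cons.prems(2) by simp
    ultimately show ?case using q(1-5) by (intro exI[of _ q]) (simp add: enc_bits_Cons)
  qed
  then show ?thesis using that by blast
qed

text \<open>The second condition of \<open>admissible\<close> on an interval, so that it can be
  split at the borders of literals and clauses.\<close>

definition clauses_ok :: "bool list \<Rightarrow> (nat \<Rightarrow> bool) \<Rightarrow> nat \<Rightarrow> nat \<Rightarrow> bool" where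
  "clauses_ok w v p q \<longleftrightarrow> (\<forall>x. p \<le> x \<and> x < q \<and> phase_at w x = InClause \<and> \<not> w ! x \<longrightarrow> sat_at w v x)"

lemma clauses_ok_split: "p \<le> q \<Longrightarrow> q \<le> r \<Longrightarrow> clauses_ok w v p r \<longleftrightarrow> clauses_ok w v p q \<and> clauses_ok w v q r"
  unfolding clauses_ok_def by (meson le_trans less_le_trans not_le)

text \<open>\<open>sat_at\<close> consults the values at sign positions only; there they have to
  come from the assignment.\<close>

definition agrees :: "bool list \<Rightarrow> (nat \<Rightarrow> bool) \<Rightarrow> (nat \<Rightarrow> bool) \<Rightarrow> bool" where
  "agrees w v \<alpha> \<longleftrightarrow> (\<forall>i n rest. i < length w \<and> phase_at w i = Sign \<and>
     drop (Suc i) w = enc_nat n @ rest \<longrightarrow> v i = \<alpha> n)"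

lemma enc_list_Nil: "enc_list f [] = [False]"
  and enc_list_Cons: "enc_list f (x # xs) = True # f x @ enc_list f xs"
  by (simp_all add: enc_list_def)

lemma enc_literal_split:
  "\<exists>n sgn. enc_literal l = sgn # enc_nat n \<and> (\<forall>\<alpha>. literal_true \<alpha> l = (\<alpha> n = sgn))"
  by (cases l) auto

text \<open>The flag \<open>sat_at w v p\<close> collects the literals already read, and the clause
  is tested once, at its end. Starting inside the clause is what the induction needs.\<close>

lemma scan_clause:
  assumes "agrees w v \<alpha>" "drop p w = enc_list enc_literal c @ rest" "phase_at w p = InClause"
  shows "\<exists>q>p. q \<le> length w \<and> drop q w = rest \<and> phase_at w q = TopLevel \<and>
    (clauses_ok w v p q \<longleftrightarrow> sat_at w v p \<or> (\<exists>l \<in> set c. literal_true \<alpha> l))"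
  using assms(2,3)
proof (induction c arbitrary: p)
  case Nil
  then have p: "p < length w" "\<not> w ! p" "drop (Suc p) w = rest"
    using drop_nth[of p w False rest] by (auto simp: enc_list_Nil)
  then show ?case using Nil(2)
    by (intro exI[of _ "Suc p"]) (auto simp: phase_at_Suc clauses_ok_def less_Suc_eq)
next
  case (Cons l c)
  obtain n sgn where l: "enc_literal l = sgn # enc_nat n" "\<forall>\<alpha>. literal_true \<alpha> l = (\<alpha> n = sgn)"
    using enc_literal_split[of l] by (elim exE conjE)
  have p: "p < length w" "w ! p" "drop (Suc p) w = sgn # enc_nat n @ enc_list enc_literal c @ rest"
    using drop_nth[of p w True "sgn # enc_nat n @ enc_list enc_literal c @ rest"] Cons.prems
    by (auto simp: enc_list_Cons l)
  have p': "Suc p < length w" "w ! Suc p = sgn" "drop (Suc (Suc p)) w = enc_nat n @ enc_list enc_literal c @ rest"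
    using drop_nth[OF p(3)] by auto
  have ph: "phase_at w (Suc p) = Sign" "phase_at w (Suc (Suc p)) = Number"
    using p p' Cons.prems(2) by (auto simp: phase_at_Suc)
  have v: "v (Suc p) = \<alpha> n"
    using assms(1) p' ph(1) unfolding agrees_def by blast
  obtain r where r: "Suc (Suc p) < r" "drop r w = enc_list enc_literal c @ rest" "phase_at w r = InClause"
     "\<And>x. Suc (Suc p) \<le> x \<Longrightarrow> x < r \<Longrightarrow> phase_at w x \<in> {Number, Bit}"
     "sat_at w v r = sat_at w v (Suc (Suc p))"
    by (rule scan_bits[OF p'(3)[unfolded enc_nat_def] ph(2)]) blast
  have sat: "sat_at w v r \<longleftrightarrow> sat_at w v p \<or> literal_true \<alpha> l"
    using r(5) ph Cons.prems(2) v p'(2) l(2) by simp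
  from Cons.IH[OF r(2,3)] obtain q where q: "q > r" "q \<le> length w" "drop q w = rest"
    "phase_at w q = TopLevel"
    "clauses_ok w v r q \<longleftrightarrow> sat_at w v r \<or> (\<exists>l \<in> set c. literal_true \<alpha> l)" by blast
  have "clauses_ok w v p r"
    unfolding clauses_ok_def
  proof (intro allI impI, elim conjE)
    fix x assume x: "p \<le> x" "x < r" "phase_at w x = InClause" "\<not> w ! x"
    from x(1) consider "x = p" | "x = Suc p" | "Suc (Suc p) \<le> x" by linarith
    then show "sat_at w v x" using x p ph r(4)[of x] by cases auto
  qed
  then show ?case
    using q r(1) sat by (intro exI[of _ q]) (auto simp: clauses_ok_split[of p r q])
qed

lemma scan_cnf:
  assumes "agrees w v \<alpha>" "drop p w = enc_cnf \<phi> @ rest" "phase_at w p = TopLevel"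
  shows "\<exists>q>p. q \<le> length w \<and> drop q w = rest \<and> (clauses_ok w v p q \<longleftrightarrow> satisfies \<alpha> \<phi>)"
  using assms(2,3)
proof (induction \<phi> arbitrary: p)
  case Nil
  then have p: "p < length w" "\<not> w ! p" "drop (Suc p) w = rest"
    using drop_nth[of p w False rest] by (auto simp: enc_list_Nil enc_cnf_def)
  then show ?case using Nil(2)
    by (intro exI[of _ "Suc p"]) (auto simp: satisfies_def clauses_ok_def less_Suc_eq)
next
  case (Cons c \<phi>)
  have p: "p < length w" "w ! p" "drop (Suc p) w = enc_list enc_literal c @ enc_cnf \<phi> @ rest"
    using drop_nth[of p w True "enc_list enc_literal c @ enc_cnf \<phi> @ rest"] Cons.prems
    by (auto simp: enc_list_Cons enc_cnf_def)
  have ph: "phase_at w (Suc p) = InClause" using p Cons.prems(2) by (simp add: phase_at_Suc)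
  from scan_clause[OF assms(1) p(3) ph] obtain r where r: "r > Suc p"
    "drop r w = enc_cnf \<phi> @ rest" "phase_at w r = TopLevel"
    "clauses_ok w v (Suc p) r \<longleftrightarrow> (\<exists>l \<in> set c. literal_true \<alpha> l)"
    using Cons.prems(2) by auto
  from Cons.IH[OF r(2,3)] obtain q where q: "q > r" "q \<le> length w" "drop q w = rest"
    "clauses_ok w v r q \<longleftrightarrow> satisfies \<alpha> \<phi>" by blast
  have "clauses_ok w v p (Suc p)" using p Cons.prems(2) by (auto simp: clauses_ok_def less_Suc_eq)
  then have "clauses_ok w v p q \<longleftrightarrow> satisfies \<alpha> (c # \<phi>)"
    using q r clauses_ok_split[of p "Suc p" q w v] clauses_ok_split[of "Suc p" r q w v]
    by (auto simp: satisfies_def)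
  then show ?case using q r(1) by (intro exI[of _ q]) auto
qed

lemma clauses_ok_enc_cnf:
  assumes "agrees (enc_cnf \<phi>) v \<alpha>"
  shows "clauses_ok (enc_cnf \<phi>) v 0 (length (enc_cnf \<phi>)) \<longleftrightarrow> satisfies \<alpha> \<phi>"
  using scan_cnf[OF assms, of 0 \<phi> "[]"] by auto

lemma phase_at_add: "phase_at w (p + r) = foldl delta (phase_at w p) (take r (drop p w))"
  by (simp add: phase_at_def take_add)

text \<open>With the shift \<open>t = j - i\<close> the comparison starts at the two sign bits and
  cannot fail along equal numerals. At their common end \<open>admissible\<close> equates the
  values, which are constant along each literal.\<close>

lemma same_variable_same_value:
  assumes v: "admissible w v" and i: "phase_at w i = Sign" "drop (Suc i) w = enc_nat n @ rest"
    and j: "j < length w" "phase_at w j = Sign" "drop (Suc j) w = enc_nat n @ rest'" and "i \<le> j"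
  shows "v i = v j"
proof -
  let ?m = "length (enc_nat n)"
  have il: "i < length w" using \<open>i \<le> j\<close> j by simp
  have ph: "phase_at w (Suc i) = Number" "phase_at w (Suc j) = Number"
    using il i j by (auto simp: phase_at_Suc)
  obtain q where q: "q = Suc i + ?m" "Suc i < q" "q \<le> length w"
    "\<And>r. Suc i \<le> r \<Longrightarrow> r < q \<Longrightarrow> phase_at w r \<in> {Number, Bit} \<and> (phase_at w r = Number \<and> \<not> w ! r \<longleftrightarrow> Suc r = q)"
    by (rule scan_bits[OF i(2)[unfolded enc_nat_def] ph(1)]) (auto simp: enc_nat_def)
  obtain q' where q': "q' = Suc j + ?m" "Suc j < q'" "q' \<le> length w"
    "\<And>r. Suc j \<le> r \<Longrightarrow> r < q' \<Longrightarrow> phase_at w r \<in> {Number, Bit} \<and> (phase_at w r = Number \<and> \<not> w ! r \<longleftrightarrow> Suc r = q')"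
    by (rule scan_bits[OF j(3)[unfolded enc_nat_def] ph(2)]) (auto simp: enc_nat_def)
  have const: "v (i + r) = v i" if "r \<le> ?m" for r
    using that
  proof (induction r)
    case (Suc r)
    then show ?case using v q(1,3) q(4)[of "i + Suc r"] unfolding admissible_def by auto
  qed simp
  have const': "v (j + r) = v j" if "r \<le> ?m" for r
    using that
  proof (induction r)
    case (Suc r)
    then show ?case using v q'(1,3) q'(4)[of "j + Suc r"] unfolding admissible_def by auto
  qed simp
  define t where "t = j - i"
  have bits: "w ! (Suc i + r) = enc_nat n ! r" "w ! (Suc j + r) = enc_nat n ! r" if "r < ?m" for r
    using that i(2) j(3) q(1,3) q'(1,3)
    by (metis add_leD1 nth_append nth_drop)+
  have phases: "phase_at w (Suc i + r) = phase_at w (Suc j + r)" if "r \<le> ?m" for r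
    using that unfolding phase_at_add ph i(2) j(3) by simp
  have match: "match_at w t (Suc j + r)" if "r < ?m" for r
    using that
  proof (induction r)
    case 0
    then show ?case using \<open>i \<le> j\<close> i j by (auto simp: t_def)
  next
    case (Suc r)
    then have "Suc j + r - t = Suc i + r" using \<open>i \<le> j\<close> by (simp add: t_def)
    then show ?case using Suc phases[of r] bits[of r] \<open>i \<le> j\<close> by (simp add: t_def ac_simps)
  qed
  \<comment> \<open>The encoding is not empty, so its end mark lies at
    \<open>Suc j + m\<close>.\<close>
  obtain m where m: "?m = Suc m" using q(1,2) by (cases ?m) auto
  let ?x = "Suc j + m"
  have x: "?x - t = Suc i + m" using \<open>i \<le> j\<close> by (simp add: t_def)
  have "phase_at w ?x = Number \<and> \<not> w ! ?x" "?x < length w"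
    using q'(1,3) q'(4)[of ?x] m by auto
  moreover have "phase_at w (?x - t) = Number \<and> \<not> w ! (?x - t)"
    unfolding x using q(1) q(4)[of "Suc i + m"] m by auto
  moreover have "match_at w t ?x" "t \<le> ?x" using match[of m] m by (auto simp: t_def)
  ultimately have "v (?x - t) = v ?x"
    using v unfolding admissible_def by blast
  then show ?thesis using m const[of ?m] const'[of ?m] x by simp
qed

section \<open>From an assignment to admissible values\<close>

definition numeral_at :: "bool list \<Rightarrow> nat \<Rightarrow> nat" where
  "numeral_at w p = (SOME n. \<exists>rest. drop p w = enc_nat n @ rest)"

text \<open>Each position inherits the value of the variable whose sign bit was read last, so values
  are constant along literals by construction.\<close>

fun value_at :: "bool list \<Rightarrow> (nat \<Rightarrow> bool) \<Rightarrow> nat \<Rightarrow> bool" where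
  "value_at w \<alpha> 0 = False"
| "value_at w \<alpha> (Suc x) =
     (if phase_at w (Suc x) = Sign then \<alpha> (numeral_at w (Suc (Suc x))) else value_at w \<alpha> x)"

lemma value_at_Sign: "phase_at w i = Sign \<Longrightarrow> value_at w \<alpha> i = \<alpha> (numeral_at w (Suc i))"
  by (cases i) auto

lemma agrees_value_at: "agrees w (value_at w \<alpha>) \<alpha>"
  unfolding agrees_def
proof (intro allI impI, elim conjE)
  fix i n rest assume i: "phase_at w i = Sign" "drop (Suc i) w = enc_nat n @ rest"
  then have "numeral_at w (Suc i) = n"
    unfolding numeral_at_def using prefix_freeD[OF prefix_free_nat] by (intro some_equality) metis+
  then show "value_at w \<alpha> i = \<alpha> n" using i by (simp add: value_at_Sign)
qed

text \<open>Unfolding the comparison backwards must end at a pair of sign bits, since inside a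
  numeral it can only be continued, never started.\<close>

lemma match_at_start:
  assumes "match_at w t x" "x < length w" "phase_at w x \<in> {Number, Bit}"
  shows "\<exists>i<x. t \<le> i \<and> phase_at w i = Sign \<and> phase_at w (i - t) = Sign \<and>
    (\<forall>r. i < r \<and> r \<le> x \<longrightarrow> phase_at w r \<in> {Number, Bit}) \<and> (\<forall>r. i < r \<and> r < x \<longrightarrow>
      phase_at w (r - t) \<in> {Number, Bit} \<and> w ! (r - t) = w ! r)"
  using assms
proof (induction x)
  case (Suc x)
  show ?case
  proof (cases "phase_at w x = Sign")
    case True
    then show ?thesis using Suc.prems by (intro exI[of _ x]) (auto simp: le_Suc_eq)
  next
    case False
    then have m: "match_at w t x" "w ! (x - t) = w ! x" "phase_at w (x - t) = phase_at w x" "t \<le> x"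
      using Suc.prems by auto
    have "delta (phase_at w x) (w ! x) \<in> {Number, Bit}"
      using Suc.prems phase_at_Suc[of x w] by auto
    then have "phase_at w x \<in> {Number, Bit}"
      using False by (cases "phase_at w x") (auto split: if_splits)
    with Suc.IH m Suc.prems obtain i where "i < x" "t \<le> i" "phase_at w i = Sign" "phase_at w (i - t) = Sign"
      "\<forall>r. i < r \<and> r \<le> x \<longrightarrow> phase_at w r \<in> {Number, Bit}"
      "\<forall>r. i < r \<and> r < x \<longrightarrow> phase_at w (r - t) \<in> {Number, Bit} \<and> w ! (r - t) = w ! r" by auto
    then show ?thesis using m Suc.prems by (intro exI[of _ i]) (auto simp: less_Suc_eq le_Suc_eq)
  qed
qed simp

text \<open>The first false bit in phase \<open>Number\<close> fixes the end of the numeral, so its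
  encoding is exactly the segment of length \<open>Suc l\<close> and is found at \<open>p'\<close>
  as well.\<close>

lemma same_segment_same_numeral:
  assumes "drop p w = enc_nat n @ rest" "phase_at w p = Number"
    and l: "phase_at w (p + l) = Number" "\<not> w ! (p + l)"
      "\<And>r. r < l \<Longrightarrow> phase_at w (p + r) \<in> {Number, Bit}"
    and same: "\<And>r. r \<le> l \<Longrightarrow> w ! (p' + r) = w ! (p + r)" "p + l < length w" "p' + l < length w"
  shows "\<exists>rest'. drop p' w = enc_nat n @ rest'"
proof -
  obtain q where q: "q = p + length (enc_nat n)" "p < q" "q \<le> length w" "phase_at w q = InClause"
    "\<And>r. p \<le> r \<Longrightarrow> r < q \<Longrightarrow> phase_at w r \<in> {Number, Bit} \<and> (phase_at w r = Number \<and> \<not> w ! r \<longleftrightarrow> Suc r = q)"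
    by (rule scan_bits[OF assms(1)[unfolded enc_nat_def] assms(2)]) (auto simp: enc_nat_def)
  have "q = Suc (p + l)"
  proof (cases "p + l < q")
    case True
    then show ?thesis using q(5)[of "p + l"] l by auto
  next
    case False
    then have "phase_at w q \<in> {Number, Bit}" using l(1) l(3)[of "q - p"] q(2)
      by (cases "q = p + l") auto
    then show ?thesis using q(4) by simp
  qed
  then have len: "length (enc_nat n) = Suc l" using q(1) by simp
  have "take (Suc l) (drop p' w) = take (Suc l) (drop p w)"
    using same by (intro nth_equalityI) (auto simp: less_Suc_eq_le)
  also have "\<dots> = enc_nat n" using assms(1) len by simp
  finally show ?thesis using append_take_drop_id[of "Suc l" "drop p' w"] by metis
qed

text \<open>Only the comparison needs an argument: successfully compared literals go back to two
  sign bits followed by equal segments, hence to the same variable.\<close>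

lemma admissible_value_at:
  assumes "clauses_ok w (value_at w \<alpha>) 0 (length w)"
  shows "admissible w (value_at w \<alpha>)"
  unfolding admissible_def
proof (intro conjI allI impI)
  fix x assume "x < length w" "phase_at w (Suc x) \<in> {Number, Bit}"
  then show "value_at w \<alpha> (Suc x) = value_at w \<alpha> x" by auto
next
  fix x assume "x < length w" "phase_at w x = InClause \<and> \<not> w ! x"
  then show "sat_at w (value_at w \<alpha>) x" using assms by (auto simp: clauses_ok_def)
next
  fix t x assume x: "x < length w" and
    "t \<le> x \<and> match_at w t x \<and> phase_at w x = Number \<and> \<not> w ! x \<and>
      phase_at w (x - t) = Number \<and> \<not> w ! (x - t)"
  then have xt: "t \<le> x" "match_at w t x" "phase_at w x = Number" "\<not> w ! x"
    "phase_at w (x - t) = Number" "\<not> w ! (x - t)" by auto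
  obtain i where i: "i < x" "t \<le> i" "phase_at w i = Sign" "phase_at w (i - t) = Sign"
    "\<And>r. i < r \<Longrightarrow> r \<le> x \<Longrightarrow> phase_at w r \<in> {Number, Bit}"
    "\<And>r. i < r \<Longrightarrow> r < x \<Longrightarrow> phase_at w (r - t) \<in> {Number, Bit} \<and> w ! (r - t) = w ! r"
    using match_at_start[OF xt(2) x] xt(3) by auto
  define l where "l = x - Suc i"
  define j where "j = i - t"
  have x_eq: "x = Suc i + l" "x - t = Suc j + l" and ij: "i = j + t" using i by (auto simp: l_def j_def)
  have jl: "j < length w" "i < length w" using i x by (auto simp: j_def)
  have ph: "phase_at w (Suc i) = Number" "phase_at w (Suc j) = Number"
    using jl i(3,4) by (auto simp: phase_at_Suc j_def)
  have mid: "phase_at w (Suc j + r) \<in> {Number, Bit}" "w ! (Suc j + r) = w ! (Suc i + r)"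
    "phase_at w (Suc i + r) \<in> {Number, Bit}" if "r < l" for r
    using i(5,6)[of "Suc i + r"] that x_eq ij by auto
  have last: "w ! (Suc j + l) = w ! (Suc i + l)" using xt x_eq by simp
  \<comment> \<open>As \<open>w\<close> is an arbitrary word, there may be no valid numeral at all.
    The equivalence for every \<open>n\<close> still makes both choices in \<open>numeral_at\<close>
    equal.\<close>
  have "(\<exists>rest. drop (Suc i) w = enc_nat n @ rest) \<longleftrightarrow> (\<exists>rest. drop (Suc j) w = enc_nat n @ rest)" for n
  proof
    assume "\<exists>rest. drop (Suc i) w = enc_nat n @ rest"
    then show "\<exists>rest. drop (Suc j) w = enc_nat n @ rest"
      using same_segment_same_numeral[of "Suc i" w n _ l "Suc j"] ph xt x x_eq mid last ij
      by (metis add_lessD1 diff_le_self le_less_trans nat_less_le)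
  next
    assume "\<exists>rest. drop (Suc j) w = enc_nat n @ rest"
    then show "\<exists>rest. drop (Suc i) w = enc_nat n @ rest"
      using same_segment_same_numeral[of "Suc j" w n _ l "Suc i"] ph xt x x_eq mid last ij
      by (metis add_lessD1 diff_le_self le_less_trans nat_less_le)
  qed
  then have "numeral_at w (Suc i) = numeral_at w (Suc j)" by (simp add: numeral_at_def)
  then have ends: "value_at w \<alpha> i = value_at w \<alpha> j"
    using i(3,4) by (simp add: value_at_Sign j_def)
  have "value_at w \<alpha> (i + r) = value_at w \<alpha> i" if "i + r \<le> x" for r
    using that
  proof (induction r)
    case (Suc r)
    then show ?case using i(5)[of "i + Suc r"] by auto
  qed simp
  from this[of "Suc l"] have 1: "value_at w \<alpha> x = value_at w \<alpha> i" using x_eq by simp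
  have "value_at w \<alpha> (j + r) = value_at w \<alpha> j" if "r \<le> Suc l" for r
    using that
  proof (induction r)
    case (Suc r)
    then show ?case using mid(1)[of r] xt(5) x_eq by (cases "r = l") auto
  qed simp
  from this[of "Suc l"] have 2: "value_at w \<alpha> (x - t) = value_at w \<alpha> j" using x_eq by simp
  show "value_at w \<alpha> (x - t) = value_at w \<alpha> x" using 1 2 ends by simp
qed

lemma enc_cnf_not_Nil [simp]: "enc_cnf \<phi> \<noteq> []"
  by (simp add: enc_cnf_def enc_list_def)

lemma satisfiable_iff_admissible: "satisfiable \<phi> \<longleftrightarrow> (\<exists>v. admissible (enc_cnf \<phi>) v)"
proof
  assume "satisfiable \<phi>"
  then obtain \<alpha> where "satisfies \<alpha> \<phi>" unfolding satisfiable_def by blast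
  then show "\<exists>v. admissible (enc_cnf \<phi>) v"
    using clauses_ok_enc_cnf[OF agrees_value_at] admissible_value_at by blast
next
  let ?w = "enc_cnf \<phi>"
  assume "\<exists>v. admissible ?w v"
  then obtain v where v: "admissible ?w v" by blast
  define occ where "occ i n \<longleftrightarrow> i < length ?w \<and> phase_at ?w i = Sign \<and>
    (\<exists>rest. drop (Suc i) ?w = enc_nat n @ rest)" for i n
  \<comment> \<open>A variable is true if one of its occurrences is; by
    \<open>same_variable_same_value\<close> all its occurrences then are. Variables that do not
    occur become false.\<close>
  define \<alpha> where "\<alpha> n = (\<exists>i. occ i n \<and> v i)" for n
  have "v i = v j" if "occ i n" "occ j n" for i j n
    using that same_variable_same_value[OF v] unfolding occ_def by (metis nat_le_linear)
  then have "agrees ?w v \<alpha>"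
    unfolding agrees_def \<alpha>_def occ_def by blast
  moreover have "clauses_ok ?w v 0 (length ?w)" using v by (auto simp: admissible_def clauses_ok_def)
  ultimately show "satisfiable \<phi>" using clauses_ok_enc_cnf unfolding satisfiable_def by blast
qed

section \<open>The table\<close>

definition data_list :: "data list" where
  "data_list = (SOME xs. set xs = UNIV \<and> distinct xs)"

lemma set_data_list [simp]: "set data_list = UNIV"
  and distinct_data_list [simp]: "distinct data_list"
proof -
  have "set data_list = UNIV \<and> distinct data_list"
    unfolding data_list_def by (rule someI_ex) (rule finite_distinct_list, rule finite)
  then show "set data_list = UNIV" "distinct data_list" by auto
qed

text \<open>A one-hot code. Its fixed length separates it from the suffix that follows in
  \<open>cell_code\<close>.\<close>

definition code :: "data \<Rightarrow> bool list" where
  "code d = map (\<lambda>d'. d' = d) data_list"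

lemma length_code: "length (code d) = length data_list"
  by (simp add: code_def)

lemma code_inject [simp]: "code d = code d' \<longleftrightarrow> d = d'"
proof
  assume "code d = code d'"
  then have "\<forall>d''. (d'' = d) = (d'' = d')" unfolding code_def map_eq_conv by simp
  then show "d = d'" by blast
qed simp

definition cell_code :: "bool list \<Rightarrow> data \<times> nat \<Rightarrow> bool list" where
  "cell_code w c = code (fst c) @ drop (snd c) w"

text \<open>Positions form the outer loop because a head runs through them, whereas the data are
  enumerated by the control.\<close>

definition cells :: "bool list \<Rightarrow> (data \<times> nat) list" where
  "cells w = concat (map (\<lambda>p. map (\<lambda>d. (d, p)) data_list) [0..<Suc (length w)])"

lemma set_cells: "set (cells w) = {c. snd c \<le> length w}"
  by (auto simp: cells_def image_iff)

lemma distinct_cells: "distinct (cells w)"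
  unfolding cells_def by (rule distinct_concat) (auto simp: distinct_map inj_on_def)

text \<open>The code of the data can be split off, and the length of the remaining suffix determines
  the position.\<close>

lemma inj_cell_code: "inj_on (cell_code w) {c. snd c \<le> length w}"
proof (rule inj_onI)
  fix c c' assume c: "c \<in> {c. snd c \<le> length w}" "c' \<in> {c. snd c \<le> length w}" "cell_code w c = cell_code w c'"
  then have "fst c = fst c'" "drop (snd c) w = drop (snd c') w"
    by (auto simp: cell_code_def length_code)
  moreover from this(2) have "length w - snd c = length w - snd c'" by (metis length_drop)
  ultimately show "c = c'" using c by (auto simp: prod_eq_iff)
qed

text \<open>Ordered as the machine prints them: for each choice of five positions, all choices of
  five data.\<close>

definition rows :: "bool list \<Rightarrow> (bool list list \<times> bool list) list" where
  "rows w = concat (map (\<lambda>ps. map (\<lambda>ds.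
     (map (cell_code w) (zip ds ps), cell_code w (local_rule w (zip ds ps))))
     (List.n_lists 5 data_list)) (List.n_lists 5 [0..<Suc (length w)]))"

definition table :: "bool list \<Rightarrow> ca_table" where
  "table w = \<lparr>tab_states = map (cell_code w) (cells w), tab_nbhd = nbhd, tab_rows = rows w,
     tab_quiescent = cell_code w (quiet w)\<rparr>"

lemma snd_local_rule: "snd (local_rule w xs) = map snd xs ! 0"
  by (simp add: local_rule_def Let_def)

lemma set_n_lists_cells:
  "(ps \<in> set (List.n_lists 5 [0..<Suc (length w)]) \<and> ds \<in> set (List.n_lists 5 data_list)) \<longleftrightarrow>
    length ps = 5 \<and> length ds = 5 \<and> set (zip ds ps) \<subseteq> {c. snd c \<le> length w}"
proof -
  have "set ps = snd ` set (zip ds ps)" if "length ps = 5" "length ds = 5"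
    using that by (metis map_snd_zip set_map)
  then show ?thesis unfolding set_n_lists by fastforce
qed

lemma set_rows: "set (rows w) = {(map (cell_code w) xs, cell_code w (local_rule w xs)) | xs.
    xs \<in> tuples {c. snd c \<le> length w} 5}"
proof -
  have "xs \<in> tuples {c. snd c \<le> length w} 5 \<longleftrightarrow> (\<exists>ps ds. xs = zip ds ps \<and>
      ps \<in> set (List.n_lists 5 [0..<Suc (length w)]) \<and> ds \<in> set (List.n_lists 5 data_list))" for xs
    unfolding set_n_lists_cells tuples_def
    by (auto intro!: exI[of _ "map snd xs"] exI[of _ "map fst xs"] simp: zip_map_fst_snd)
  then show ?thesis unfolding rows_def by (fastforce simp: image_iff)
qed

lemma inj_on_map_cell_code: "inj_on (map (cell_code w)) (tuples {c. snd c \<le> length w} k)"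
proof (rule inj_onI)
  fix xs ys assume "xs \<in> tuples {c. snd c \<le> length w} k" "ys \<in> tuples {c. snd c \<le> length w} k"
    "map (cell_code w) xs = map (cell_code w) ys"
  moreover from this have "inj_on (cell_code w) (set xs \<union> set ys)"
    by (intro inj_on_subset[OF inj_cell_code]) (auto simp: tuples_def)
  ultimately show "xs = ys" using inj_on_map_eq_map by blast
qed

lemma distinct_rows: "distinct (map fst (rows w))"
proof -
  let ?P = "List.n_lists 5 [0..<Suc (length w)]" and ?D = "List.n_lists 5 data_list"
  have eq: "map fst (rows w) = map (\<lambda>(ps, ds). map (cell_code w) (zip ds ps)) (List.product ?P ?D)"
    by (simp add: rows_def product_concat_map map_concat comp_def)
  have "inj_on (\<lambda>(ps, ds). map (cell_code w) (zip ds ps)) (set ?P \<times> set ?D)"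
  proof (rule inj_onI, clarify)
    fix ps ds ps' ds'
    assume *: "ps \<in> set ?P" "ds \<in> set ?D" "ps' \<in> set ?P" "ds' \<in> set ?D"
      "map (cell_code w) (zip ds ps) = map (cell_code w) (zip ds' ps')"
    then have l: "length ps = 5" "length ds = 5" "set (zip ds ps) \<subseteq> {c. snd c \<le> length w}"
      "length ps' = 5" "length ds' = 5" "set (zip ds' ps') \<subseteq> {c. snd c \<le> length w}"
      using set_n_lists_cells by blast+
    then have "zip ds ps = zip ds' ps'"
      by (intro inj_onD[OF inj_on_map_cell_code *(5), of 5]) (auto simp: tuples_def)
    then show "ps = ps' \<and> ds = ds'" using l by (metis map_fst_zip map_snd_zip)
  qed
  then show ?thesis
    unfolding eq distinct_map by (simp add: distinct_product distinct_n_lists)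
qed

lemma local_table:
  assumes "xs \<in> tuples {c. snd c \<le> length w} 5"
  shows "ca_local (ca_of (table w)) (map (cell_code w) xs) = cell_code w (local_rule w xs)"
proof -
  have "(map (cell_code w) xs, cell_code w (local_rule w xs)) \<in> set (rows w)"
    using assms unfolding set_rows by blast
  with distinct_rows[of w] show ?thesis by (simp add: ca_of_def table_def)
qed

lemma local_rule_closed:
  "xs \<in> tuples {c. snd c \<le> length w} 5 \<Longrightarrow> snd (local_rule w xs) \<le> length w"
  by (cases xs) (auto simp: snd_local_rule tuples_def)

lemma length_nbhd [simp]: "length nbhd = 5"
  by (simp add: nbhd_def)

lemma states_table: "ca_states (ca_of (table w)) = cell_code w ` {c. snd c \<le> length w}"
  by (simp add: ca_of_def table_def set_cells)

lemma nbhd_table: "ca_nbhd (ca_of (table w)) = nbhd"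
  by (simp add: ca_of_def table_def)

lemma tuples_image: "tuples (f ` S) k = map f ` tuples S k"
proof
  show "tuples (f ` S) k \<subseteq> map f ` tuples S k"
  proof
    fix ys assume "ys \<in> tuples (f ` S) k"
    then have "\<forall>i < k. \<exists>x. x \<in> S \<and> ys ! i = f x" and l: "length ys = k" by (auto simp: tuples_def) (metis imageE nth_mem subsetD)
    then obtain g where g: "\<And>i. i < k \<Longrightarrow> g i \<in> S \<and> ys ! i = f (g i)" by metis
    then have "ys = map f (map g [0..<k])" using l by (intro nth_equalityI) auto
    moreover have "map g [0..<k] \<in> tuples S k" using g by (auto simp: tuples_def)
    ultimately show "ys \<in> map f ` tuples S k" by blast
  qed
qed (fastforce simp: tuples_def)

lemma wf_table: "wf_ca_table (table w)"
proof -
  let ?S = "{c :: data \<times> nat. snd c \<le> length w}"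
  have fin: "finite ?S" using finite_set[of "cells w"] by (simp only: set_cells)
  have quiet: "quiet w \<in> ?S" by (simp add: quiet_def)
  have 1: "distinct (tab_states (table w))"
    by (simp add: table_def distinct_map distinct_cells set_cells inj_cell_code)
  have 2: "set (map fst (tab_rows (table w))) = tuples (set (tab_states (table w))) (length (tab_nbhd (table w)))"
    by (auto simp: table_def set_rows set_cells tuples_image image_iff)
  have 3: "wf_ca (ca_of (table w))"
    unfolding wf_ca_def states_table nbhd_table
  proof (intro conjI ballI)
    show "finite (cell_code w ` ?S)" using fin by simp
    show "cell_code w ` ?S \<noteq> {}" using quiet by blast
    show "distinct nbhd" by (simp add: nbhd_def)
    fix xs assume "xs \<in> tuples (cell_code w ` ?S) (length nbhd)"
    then obtain ys where "ys \<in> tuples ?S 5" "xs = map (cell_code w) ys" by (auto simp: tuples_image)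
    then show "ca_local (ca_of (table w)) xs \<in> cell_code w ` ?S"
      using local_rule_closed[of ys w] by (auto simp: local_table)
  qed
  have "local_rule w (replicate 5 (quiet w)) = quiet w"
    by (simp add: local_rule_def Let_def rule_None quiet_def)
  moreover have "replicate 5 (quiet w) \<in> tuples ?S 5" using quiet by (auto simp: tuples_def)
  ultimately have "ca_local (ca_of (table w)) (map (cell_code w) (replicate 5 (quiet w))) = cell_code w (quiet w)"
    by (simp only: local_table)
  then have 4: "quiescent (ca_of (table w)) (tab_quiescent (table w))"
    using quiet unfolding quiescent_def states_table nbhd_table by (simp add: table_def)
  show ?thesis
    unfolding wf_ca_table_def using 1 2 3 4 distinct_rows[of w] by (simp add: table_def)
qed

section \<open>Transfer to the automaton given by its table\<close>

lemma apply_table: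
  assumes "\<And>y. snd (X y) \<le> length w"
  shows "ca_apply (ca_of (table w)) (\<lambda>y. cell_code w (X y)) = (\<lambda>y. cell_code w (global w X y))"
proof
  fix y
  have "map (\<lambda>x. X (y + x)) nbhd \<in> tuples {c. snd c \<le> length w} 5"
    using assms by (simp add: tuples_def image_subset_iff)
  from local_table[OF this] show "ca_apply (ca_of (table w)) (\<lambda>y. cell_code w (X y)) y = cell_code w (global w X y)"
    by (simp add: ca_apply_def nbhd_table global_def comp_def)
qed

lemma global_closed: "(\<And>y. snd (X y) \<le> length w) \<Longrightarrow> snd (global w X y) \<le> length w"
  by (simp add: global_def snd_local_rule nbhd_def)

text \<open>A collision of finite configurations yields a tableau of some height, hence admissible
  values. Conversely, admissible values give a tableau that occupies \<open>length w + 1\<close>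
  columns and \<open>length w + 2\<close> rows; the bounds on \<open>i\<close> and \<open>j\<close>
  make room for it.\<close>

lemma not_injective_table_iff:
  assumes w: "w \<noteq> []" and n: "length w < i" "Suc (length w) < j"
  shows "\<not> injective_inside (ca_of (table w)) (tab_quiescent (table w)) i j \<longleftrightarrow> (\<exists>v. admissible w v)"
proof
  let ?q = "cell_code w (quiet w)" and ?L = "length w"
  let ?K = "configs_inside (ca_of (table w)) ?q i j"
  have q: "tab_quiescent (table w) = ?q" by (simp add: table_def)
  assume "\<not> injective_inside (ca_of (table w)) (tab_quiescent (table w)) i j"
  then obtain C C' where C: "C \<in> ?K" "C' \<in> ?K" "C \<noteq> C'"
    "ca_apply (ca_of (table w)) C = ca_apply (ca_of (table w)) C'"
    unfolding injective_inside_def inj_on_def q by blast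
  have decode: "\<exists>X. (\<forall>y. snd (X y) \<le> ?L) \<and> D = (\<lambda>y. cell_code w (X y)) \<and> finite {y. X y \<noteq> quiet w}"
    if "D \<in> ?K" for D
  proof -
    from that have r: "range D \<subseteq> cell_code w ` {c. snd c \<le> ?L}" and f: "finite {y. D y \<noteq> ?q}"
      by (auto simp: configs_inside_def finite_configuration_def configuration_def states_table)
    from r have "\<forall>y. \<exists>c. snd c \<le> ?L \<and> D y = cell_code w c" by blast
    then obtain X where X: "\<And>y. snd (X y) \<le> ?L" "\<And>y. D y = cell_code w (X y)" by metis
    have "{y. X y \<noteq> quiet w} \<subseteq> {y. D y \<noteq> ?q}"
      using X inj_onD[OF inj_cell_code, of w "X y" "quiet w" for y] by (auto simp: quiet_def)
    with f have "finite {y. X y \<noteq> quiet w}" by (rule rev_finite_subset)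
    with X show ?thesis by blast
  qed
  obtain X X' where X: "\<And>y. snd (X y) \<le> ?L" "C = (\<lambda>y. cell_code w (X y))" "finite {y. X y \<noteq> quiet w}"
    and X': "\<And>y. snd (X' y) \<le> ?L" "C' = (\<lambda>y. cell_code w (X' y))" "finite {y. X' y \<noteq> quiet w}"
    using decode[OF C(1)] decode[OF C(2)] by blast
  have "global w X y = global w X' y" for y
  proof (rule inj_onD[OF inj_cell_code])
    show "cell_code w (global w X y) = cell_code w (global w X' y)"
      using fun_cong[OF C(4), of y] unfolding X(2) X'(2) by (simp add: apply_table X(1) X'(1))
  qed (use X(1) X'(1) global_closed in auto)
  then have "global w X = global w X'" by auto
  moreover have "X \<noteq> X'" using C(3) X(2) X'(2) by auto
  ultimately obtain g H where "tableau w g H"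
    using collision_imp_tableau[OF w _ _ X(1) X(3) X'(3)] by blast
  then show "\<exists>v. admissible w v" using tableau_imp_admissible[OF w] by blast
next
  let ?q = "cell_code w (quiet w)" and ?L = "length w"
  let ?K = "configs_inside (ca_of (table w)) ?q i j"
  have q: "tab_quiescent (table w) = ?q" by (simp add: table_def)
  assume "\<exists>v. admissible w v"
  then obtain g where "tableau w g (Suc ?L)" using admissible_imp_tableau[OF w] by blast
  then obtain X X' where X: "X \<noteq> X'" "global w X = global w X'"
    "\<And>y. snd (X y) \<le> length w" "\<And>y. snd (X' y) \<le> length w"
    "\<And>y. y \<notin> {0..int ?L} \<times> {0..int (Suc ?L)} \<Longrightarrow> X y = quiet w \<and> X' y = quiet w"
    using tableau_imp_collision[OF w] by metis
  have inside: "(\<lambda>y. cell_code w (Z y)) \<in> ?K"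
    if "\<And>y. snd (Z y) \<le> ?L" "\<And>y. y \<notin> {0..int ?L} \<times> {0..int (Suc ?L)} \<Longrightarrow> Z y = quiet w" for Z
  proof -
    have "{y. cell_code w (Z y) \<noteq> ?q} \<subseteq> {0..int ?L} \<times> {0..int (Suc ?L)}"
    proof
      fix y assume "y \<in> {y. cell_code w (Z y) \<noteq> ?q}"
      then have "Z y \<noteq> quiet w" by auto
      then show "y \<in> {0..int ?L} \<times> {0..int (Suc ?L)}" using that(2) by blast
    qed
    moreover have "{0..int ?L} \<times> {0..int (Suc ?L)} \<subseteq> {0..<int i} \<times> {0..<int j}" using n by auto
    moreover have "finite ({0..int ?L} \<times> {0..int (Suc ?L)})" by simp
    ultimately show ?thesis using that(1)
      unfolding configs_inside_def finite_configuration_def configuration_def states_table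
      by (auto intro: finite_subset)
  qed
  have "(\<lambda>y. cell_code w (X y)) \<in> ?K" "(\<lambda>y. cell_code w (X' y)) \<in> ?K"
    by (rule inside, rule X, use X(5) in blast)+
  moreover have "ca_apply (ca_of (table w)) (\<lambda>y. cell_code w (X y)) = ca_apply (ca_of (table w)) (\<lambda>y. cell_code w (X' y))"
    using X by (simp add: apply_table)
  moreover obtain y where "X y \<noteq> X' y" using X(1) by blast
  then have "cell_code w (X y) \<noteq> cell_code w (X' y)"
    using inj_onD[OF inj_cell_code, of w "X y" "X' y"] X(3,4) by auto
  then have "(\<lambda>y. cell_code w (X y)) \<noteq> (\<lambda>y. cell_code w (X' y))" by metis
  ultimately show "\<not> injective_inside (ca_of (table w)) (tab_quiescent (table w)) i j"
    unfolding injective_inside_def inj_on_def q by blast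
qed

section \<open>The reduction\<close>

definition zero_on :: "nat set \<Rightarrow> bool list \<Rightarrow> (nat \<Rightarrow> int) \<Rightarrow> bool" where
  "zero_on I w h \<longleftrightarrow> (\<forall>i \<in> I. h i = 0)"

text \<open>For nested loops: the body may rely on the heads of the inner loops being at
  \<open>0\<close>, while head \<open>i\<close> varies.\<close>

lemma emits_For_zero:
  assumes "emits (zero_on I) c g" "i < 7" "i \<noteq> 1" "i \<noteq> 6" "i \<notin> I"
  shows "emits (zero_on (insert i I)) (For i c)
    (\<lambda>w h. concat (map (\<lambda>p. g w (h(i := int p))) [0..<Suc (length w)]))"
  using assms by (intro emits_For[of "zero_on I"]) (auto simp: zero_on_def)

section \<open>Programs that print the table\<close>

definition Cell :: "nat \<Rightarrow> data \<Rightarrow> com" where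
  "Cell i d = Seq (Print (spread (code d))) (Seq (Suffix i) (Print [False]))"

lemma emits_Cell:
  "i < 7 \<Longrightarrow> i \<noteq> 1 \<Longrightarrow> i \<noteq> 6 \<Longrightarrow> emits P (Cell i d) (\<lambda>w h. enc_bits (cell_code w (d, nat (h i))))"
  unfolding Cell_def
  by (rule emits_conv[where P = P, OF emits_Seq[OF emits_Print emits_Seq[OF emits_Suffix emits_Print]]])
     (simp_all add: enc_bits_spread cell_code_def spread_def)

lemma concat_map_concat: "concat (map f (concat xss)) = concat (map (\<lambda>xs. concat (map f xs)) xss)"
  by (induction xss) auto

definition States :: com where
  "States = Seq (For 0 (seqs (map (\<lambda>d. Seq (Print [True]) (Cell 0 d)) data_list))) (Print [False])"

lemma emits_States:
  "emits (zero_on {0}) States (\<lambda>w h. enc_list enc_bits (map (cell_code w) (cells w)))"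
  unfolding States_def
proof (rule emits_conv[where P = "zero_on {0}"])
  show "emits (zero_on {0}) (Seq (For 0 (seqs (map (\<lambda>d. Seq (Print [True]) (Cell 0 d)) data_list))) (Print [False]))
    (\<lambda>w h. concat (map (\<lambda>p. concat (map (\<lambda>d. [True] @ enc_bits (cell_code w (d, nat ((h(0 := int p)) 0)))) data_list))
        [0..<Suc (length w)]) @ [False])"
    by (intro emits_Seq emits_For_zero emits_seqs emits_Cell emits_Print) simp_all
qed (simp_all add: cells_def enc_list_def concat_map_concat comp_def del: upt_Suc)

text \<open>The heads for the cell itself and its right, left, upper and lower neighbour, in the
  order of \<open>nbhd\<close>. Hence the tests in \<open>Rows_at\<close> compare head
  \<open>0\<close> with head \<open>2\<close> (right) and head \<open>4\<close> (upper).\<close>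

definition tapes :: "nat list" where
  "tapes = [0, 2, 3, 4, 5]"

text \<open>Once the symbol and the outcomes of both tests are fixed, the new data depend on the
  five old data only and are constants of the program.\<close>

definition Rows_for :: "nat \<Rightarrow> bool \<Rightarrow> bool \<Rightarrow> com" where
  "Rows_for n e e' = seqs (map (\<lambda>ds. Seq (Print [True]) (Seq
     (seqs (map (\<lambda>k. Seq (Print [True]) (Cell (tapes ! k) (ds ! k))) [0..<5]))
     (Seq (Print [False]) (Cell 0 (rule n e e' ds))))) (List.n_lists 5 data_list))"

definition row_code :: "bool list \<Rightarrow> nat list \<Rightarrow> data list \<Rightarrow> bool list" where
  "row_code w ps ds = True # enc_pair (enc_list enc_bits) enc_bits
     (map (cell_code w) (zip ds ps), cell_code w (local_rule w (zip ds ps)))"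

lemma emits_Rows_for:
  "emits P (Rows_for n e e') (\<lambda>w h. concat (map (\<lambda>ds. [True] @
     (concat (map (\<lambda>k. [True] @ enc_bits (cell_code w (ds ! k, nat (h (tapes ! k))))) [0..<5])) @
     [False] @ enc_bits (cell_code w (rule n e e' ds, nat (h 0)))) (List.n_lists 5 data_list)))"
proof -
  have "tapes ! k < 7 \<and> tapes ! k \<noteq> 1 \<and> tapes ! k \<noteq> 6" if "k \<in> set [0..<5]" for k
    using that by (auto simp: tapes_def nth_Cons' )
  then show ?thesis
    unfolding Rows_for_def by (intro emits_seqs emits_Seq emits_Cell emits_Print) simp_all
qed

definition Rows_at :: com where
  "Rows_at = Case 0 5 (\<lambda>n. Succ 0 2
     (Equal 0 4 (Rows_for n True True) (Rows_for n True False))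
     (Equal 0 4 (Rows_for n False True) (Rows_for n False False)))"

lemma emits_Rows_at:
  "emits P Rows_at (\<lambda>w h. concat (map (row_code w (map (\<lambda>i. nat (h i)) tapes)) (List.n_lists 5 data_list)))"
proof (rule emits_conv[where P = P])
  let ?g = "\<lambda>n e e' w h. concat (map (\<lambda>ds. [True] @
     (concat (map (\<lambda>k. [True] @ enc_bits (cell_code w (ds ! k, nat (h (tapes ! k))))) [0..<5])) @
     [False] @ enc_bits (cell_code w (rule n e e' ds, nat (h 0)))) (List.n_lists 5 data_list))"
  let ?G = "\<lambda>n w h. if h 2 = h 0 + 1
     then (if h 0 = h 4 then ?g n True True w h else ?g n True False w h)
     else (if h 0 = h 4 then ?g n False True w h else ?g n False False w h)"
  show "emits P Rows_at (\<lambda>w h. if marked w (h 0) < 5 then ?G (marked w (h 0)) w h else [])"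
    unfolding Rows_at_def by (intro emits_Case emits_Succ emits_Equal emits_Rows_for) simp_all
  fix w h assume h: "in_range w h" "P w h"
  let ?ps = "map (\<lambda>i. nat (h i)) tapes"
  have pos: "0 \<le> h i" for i using h(1) by (simp add: in_range_def)
  have iff: "nat (h 2) = Suc (nat (h 0)) \<longleftrightarrow> h 2 = h 0 + 1" "nat (h 4) = nat (h 0) \<longleftrightarrow> h 0 = h 4"
    using pos[of 0] pos[of 2] pos[of 4] by auto
  have row: "[True] @ (concat (map (\<lambda>k. [True] @ enc_bits (cell_code w (ds ! k, nat (h (tapes ! k))))) [0..<5])) @
      [False] @ enc_bits (cell_code w (rule (marked w (h 0)) (h 2 = h 0 + 1) (h 0 = h 4) ds, nat (h 0)))
      = row_code w ?ps ds" if "ds \<in> set (List.n_lists 5 data_list)" for ds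
  proof -
    have "length ds = 5" using that by (simp add: set_n_lists)
    then have "ds = map ((!) ds) [0..<5]" by (metis map_nth)
    then obtain a b c d e where "ds = [a, b, c, d, e]" by (simp add: upt_rec)
    then show ?thesis
      using iff pos[of 0]
      by (simp add: row_code_def enc_pair_def enc_list_def local_rule_def Let_def tapes_def upt_rec)
  qed
  have "?G n w h = ?g n (h 2 = h 0 + 1) (h 0 = h 4) w h" for n by simp
  also have "?g (marked w (h 0)) (h 2 = h 0 + 1) (h 0 = h 4) w h =
      concat (map (row_code w ?ps) (List.n_lists 5 data_list))"
    by (rule arg_cong[where f = concat], rule map_cong[OF refl], rule row)
  finally show "P w h \<and> (if marked w (h 0) < 5 then ?G (marked w (h 0)) w h else []) =
      concat (map (row_code w ?ps) (List.n_lists 5 data_list))"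
    using h(2) marked_less_5 by simp
qed

text \<open>\<open>List.n_lists\<close> varies the first entry fastest, so the loop for head
  \<open>0\<close> is the innermost one in \<open>Rows\<close>.\<close>

lemma concat_map_n_lists:
  "concat (map F (List.n_lists (Suc n) xs)) =
     concat (map (\<lambda>ys. concat (map (\<lambda>y. F (y # ys)) xs)) (List.n_lists n xs))"
  by (simp add: concat_map_concat comp_def)

lemma rows_code:
  "concat (map (\<lambda>r. True # enc_pair (enc_list enc_bits) enc_bits r) (rows w)) =
     concat (map (\<lambda>ps. concat (map (row_code w ps) (List.n_lists 5 data_list)))
       (List.n_lists 5 [0..<Suc (length w)]))"
  unfolding rows_def concat_map_concat map_map comp_def row_code_def ..

definition Rows :: com where
  "Rows = Seq (For 5 (For 4 (For 3 (For 2 (For 0 Rows_at))))) (Print [False])"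

lemma emits_Rows:
  "emits (zero_on {0, 2, 3, 4, 5}) Rows (\<lambda>w h. enc_list (enc_pair (enc_list enc_bits) enc_bits) (rows w))"
proof (rule emits_conv)
  let ?F = "\<lambda>w ps. concat (map (row_code w ps) (List.n_lists 5 data_list))"
  show "emits (zero_on {5, 4, 3, 2, 0}) Rows (\<lambda>w h.
     concat (map (\<lambda>p5. concat (map (\<lambda>p4. concat (map (\<lambda>p3. concat (map (\<lambda>p2. concat (map (\<lambda>p0.
       ?F w (map (\<lambda>i. nat ((h(5 := int p5, 4 := int p4, 3 := int p3, 2 := int p2, 0 := int p0)) i)) tapes))
       [0..<Suc (length w)])) [0..<Suc (length w)])) [0..<Suc (length w)])) [0..<Suc (length w)])) [0..<Suc (length w)])
       @ [False])"
    unfolding Rows_def by (intro emits_Seq emits_Print emits_For_zero emits_Rows_at) simp_all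
  fix w h assume "zero_on {0, 2, 3, 4, 5} w h"
  then show "zero_on {5, 4, 3, 2, 0} w h \<and>
     concat (map (\<lambda>p5. concat (map (\<lambda>p4. concat (map (\<lambda>p3. concat (map (\<lambda>p2. concat (map (\<lambda>p0.
       ?F w (map (\<lambda>i. nat ((h(5 := int p5, 4 := int p4, 3 := int p3, 2 := int p2, 0 := int p0)) i)) tapes))
       [0..<Suc (length w)])) [0..<Suc (length w)])) [0..<Suc (length w)])) [0..<Suc (length w)])) [0..<Suc (length w)])
       @ [False] = enc_list (enc_pair (enc_list enc_bits) enc_bits) (rows w)"
    unfolding enc_list_def[of "enc_pair _ _"] rows_code
    by (simp add: eval_nat_numeral concat_map_n_lists tapes_def zero_on_def del: upt_Suc n_lists.simps(2))
qed

section \<open>The size of the rectangle and the complete program\<close>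

lemma nat_bits_ones: "nat_bits (2 ^ k - 1) = replicate k True"
proof (induction k)
  case (Suc k)
  have "2 ^ Suc k - 1 = 2 * (2 ^ k - 1) + (1 :: nat)"
    using one_le_power[of "2 :: nat" k] by (simp only: power_Suc) linarith
  then show ?case using Suc by (subst nat_bits.simps) simp
qed (simp add: nat_bits.simps)

definition Ones :: com where
  "Ones = Seq (For 0 (Print [True, True])) (Print [False])"

lemma emits_Ones: "emits (zero_on {0}) Ones (\<lambda>w h. enc_nat (2 ^ Suc (length w) - 1))"
proof (rule emits_conv)
  show "emits (zero_on {0}) Ones (\<lambda>w h. concat (map (\<lambda>p. [True, True]) [0..<Suc (length w)]) @ [False])"
    unfolding Ones_def by (intro emits_Seq emits_For_zero emits_Print) simp_all
  have "concat (map (\<lambda>p. [True, True]) [0..<n]) = spread (replicate n True)" for n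
    by (induction n) (simp_all add: spread_def replicate_append_same[symmetric])
  then show "zero_on {0} w h \<and> concat (map (\<lambda>p. [True, True]) [0..<Suc (length w)]) @ [False] =
      enc_nat (2 ^ Suc (length w) - 1)" if "zero_on {0} w h" for w h
    unfolding enc_nat_def nat_bits_ones enc_bits_spread using that by (simp only: simp_thms)
qed

definition Reduction :: com where
  "Reduction = seqs [States, Print (enc_list (enc_pair enc_int enc_int) nbhd), Rows,
     Print (enc_bits (code (None, False, False, False))), Ones, Ones]"

text \<open>A number above \<open>length w\<close> whose binary digits are all 1. It is printed by a
  single loop without arithmetic, and it has only \<open>length w + 1\<close> digits although it is
  exponentially large.\<close>

definition size_bound :: "bool list \<Rightarrow> nat" where
  "size_bound w = 2 ^ Suc (length w) - 1"

lemma emits_Reduction: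
  "emits (zero_on {0, 2, 3, 4, 5}) Reduction (\<lambda>w h. enc_output (table w, size_bound w, size_bound w))"
proof (rule emits_conv)
  let ?P = "zero_on {0, 2, 3, 4, 5}"
  have "emits ?P States (\<lambda>w h. enc_list enc_bits (map (cell_code w) (cells w)))"
    "emits ?P Ones (\<lambda>w h. enc_nat (2 ^ Suc (length w) - 1))"
    by (rule emits_conv[OF emits_States] emits_conv[OF emits_Ones], simp add: zero_on_def)+
  note emits = emits_Seq emits_Skip emits_Print this emits_Rows
  show "emits ?P Reduction (\<lambda>w h. enc_list enc_bits (map (cell_code w) (cells w)) @
      enc_list (enc_pair enc_int enc_int) nbhd @
      enc_list (enc_pair (enc_list enc_bits) enc_bits) (rows w) @
      enc_bits (code (None, False, False, False)) @
      enc_nat (2 ^ Suc (length w) - 1) @ enc_nat (2 ^ Suc (length w) - 1) @ [])"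
    unfolding Reduction_def seqs.simps by (intro emits)
qed (simp add: enc_output_def enc_pair_def enc_ca_table_def table_def cell_code_def quiet_def size_bound_def)

lemma wf_Reduction: "wf_com 7 5 Reduction"
proof -
  have "wf_com 7 5 (Cell i d)" for i d by (simp add: Cell_def wf_Print wf_Suffix)
  note wf = this wf_Print wf_For wf_Case wf_Succ wf_Equal
  have "wf_com 7 5 (Rows_for n e e')" for n e e'
    unfolding Rows_for_def by (intro wf_seqs) (auto simp: wf intro!: wf_seqs)
  then have "wf_com 7 5 Rows" by (simp add: Rows_def Rows_at_def wf)
  moreover have "wf_com 7 5 States" by (auto simp: States_def wf intro!: wf_For wf_seqs)
  moreover have "wf_com 7 5 Ones" by (simp add: Ones_def wf)
  ultimately show ?thesis by (simp add: Reduction_def wf)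
qed

theorem theorem3p1:
  "\<exists>(T :: cnf \<Rightarrow> ca_table) (n :: cnf \<Rightarrow> nat) (m :: cnf \<Rightarrow> nat).
     poly_time_computable enc_cnf enc_output (\<lambda>\<phi>. (T \<phi>, n \<phi>, m \<phi>)) \<and>
     (\<forall>\<phi>. wf_ca_table (T \<phi>) \<and> n \<phi> \<ge> 1 \<and> m \<phi> \<ge> 1 \<and>
        (satisfiable \<phi> \<longleftrightarrow>
           \<not> injective_inside (ca_of (T \<phi>)) (tab_quiescent (T \<phi>)) (n \<phi> + 1) (m \<phi> + 2)))"
proof (intro exI conjI allI)
  let ?T = "\<lambda>\<phi>. table (enc_cnf \<phi>)" and ?n = "\<lambda>\<phi>. size_bound (enc_cnf \<phi>)"
  show "poly_time_computable enc_cnf enc_output (\<lambda>\<phi>. (?T \<phi>, ?n \<phi>, ?n \<phi>))"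
  proof (rule emits_poly_time)
    show "emits (\<lambda>w h. h = (\<lambda>_. 0)) Reduction (\<lambda>w h. enc_output (table w, size_bound w, size_bound w))"
      by (rule emits_conv[OF emits_Reduction]) (simp add: zero_on_def)
  qed (simp_all add: wf_Reduction)
  fix \<phi>
  have "length (enc_cnf \<phi>) < 2 ^ length (enc_cnf \<phi>)" by simp
  moreover have "2 ^ Suc (length (enc_cnf \<phi>)) = 2 * (2 ^ length (enc_cnf \<phi>) :: nat)" by simp
  ultimately have L: "length (enc_cnf \<phi>) < ?n \<phi>" unfolding size_bound_def by linarith
  then show "?n \<phi> \<ge> 1" "?n \<phi> \<ge> 1" by linarith+
  show "wf_ca_table (?T \<phi>)" by (rule wf_table)
  show "satisfiable \<phi> \<longleftrightarrow>
      \<not> injective_inside (ca_of (?T \<phi>)) (tab_quiescent (?T \<phi>)) (?n \<phi> + 1) (?n \<phi> + 2)"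
    using L by (simp add: not_injective_table_iff satisfiable_iff_admissible)
qed

end
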